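(* Let $\mathcal{R}^\infty_C$ be the metric exclusion ideal on $\mathbb{R}^\infty$ obtained by excluding a cone $C\subset\mathbb{R}^\infty$. Assume that $C_m=\pi_mC$ is a strict subset of $\mathbb{R}^m$ for all sufficiently large $m$. Let $\xi$ be a random element in $\mathbb{R}^\infty$. Then $\xi\in\mathrm{RV}(\mathbb{R}^\infty,\cdot,\mathcal{R}^\infty_C,g,\mu)$ for some $\mu\in M(\mathcal{R}^\infty_C)$ if and only if $\pi_m(\xi)\in\mathrm{RV}(\mathbb{R}^m,\cdot,\mathcal{R}^m_{C_m},g,\mu_m)$ for all sufficiently large $m$, where $\mathcal{R}^m_{C_m}$ is the metric exclusion ideal on $\mathbb{R}^m$ with the Euclidean metric obtained by excluding $C_m$ and $\mu_m\in M(\mathcal{R}^m_{C_m})$ is a Borel measure on $\mathbb{R}^m$; and then $\mu_m=\pi_m\mu$.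
   Context: $\mathbb{R}^\infty$ is the space of real sequences $x=(x_1,x_2,\dots)$ with linear scaling $T_tx=tx$ (denoted by $\cdot$) and the metric $d(x,y)=\sum_{i\ge1}2^{-i}\min(|x_i-y_i|,1)$. $\pi_mx=(x_1,\dots,x_m)$. A cone is a set $C$ with $tC=C$ for all $t>0$. An ideal is a family of subsets closed under finite unions and subsets. For a set $C$ in a metric space $(X,d)$, the metric exclusion ideal obtained by excluding $C$ is the smallest ideal containing the sets $\{x:d(x,C)\ge r\}$ for all $r>0$. $M(\mathcal{S})$ is the family of Borel measures finite on Borel sets of the ideal $\mathcal{S}$ and vanishing outside the union $U_{\mathcal{S}}$ of its sets. $\xi\in\mathrm{RV}(X,\cdot,\mathcal{S},g,\mu)$ means: $g:[0,\infty)\to[0,\infty)$ is measurable with $g(t)\to\infty$ as $t\to\infty$; $\mu\in M(\mathcal{S})$ with $\mu(B)>0$ for some $B\in\mathcal{S}$; and $g(t)\mathbf{E}f(t^{-1}\xi)\to\int f\,d\mu$ as $t\to\infty$ for all bounded continuous $f:U_{\mathcal{S}}\to\mathbb{R}$ with support (closure in $X$ of $\{f\neq0\}$) in $\mathcal{S}$. $\pi_m\mu$ is the pushforward of $\mu$, considered on sets of $\mathcal{R}^m_{C_m}$. *)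

theory Defs
  imports "HOL-Probability.Probability"
begin

section \<open>The metric spaces of sequences and of finite vectors\<close>

text \<open>Coordinates are numbered from 0, so the coordinate \<open>x\<^sub>i\<close> with \<open>i \<ge> 1\<close> is \<open>x (i - 1)\<close> here.\<close>

definition seq_dist :: "(nat \<Rightarrow> real) \<Rightarrow> (nat \<Rightarrow> real) \<Rightarrow> real" where
  "seq_dist x y = (\<Sum>i. (1/2) ^ Suc i * min \<bar>x i - y i\<bar> 1)"

definition seq_metric :: "(nat \<Rightarrow> real) metric" where
  "seq_metric = metric (UNIV, seq_dist)"

text \<open>As in \<^const>\<open>Euclidean_space\<close>, a vector of length \<open>m\<close> is a sequence vanishing from
  index \<open>m\<close> on, so that \<open>m\<close> can be quantified over.\<close>

definition Rm_metric :: "nat \<Rightarrow> (nat \<Rightarrow> real) metric" where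
  "Rm_metric m = metric (topspace (Euclidean_space m), \<lambda>x y. L2_set (\<lambda>i. x i - y i) {..<m})"

definition seq_proj :: "nat \<Rightarrow> (nat \<Rightarrow> real) \<Rightarrow> (nat \<Rightarrow> real)" where
  "seq_proj m x = (\<lambda>i. if i < m then x i else 0)"

definition seq_scale :: "real \<Rightarrow> (nat \<Rightarrow> real) \<Rightarrow> (nat \<Rightarrow> real)" where
  "seq_scale t x = (\<lambda>i. t * x i)"

text \<open>Unlike the cones of HOL-Analysis, a cone need not contain the origin.\<close>

definition seq_cone :: "(nat \<Rightarrow> real) set \<Rightarrow> bool" where
  "seq_cone C \<longleftrightarrow> (\<forall>t>0. seq_scale t ` C = C)"

lemma summable_seq_dist: "summable (\<lambda>i. (1/2) ^ Suc i * min \<bar>x i - y i\<bar> (1::real))"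
proof (rule summable_comparison_test')
  show "summable (\<lambda>i. (1/2) ^ Suc i :: real)"
    by (subst summable_Suc_iff) (simp add: summable_geometric)
  show "norm ((1/2) ^ Suc i * min \<bar>x i - y i\<bar> (1::real)) \<le> (1/2) ^ Suc i" for i
    by (simp add: abs_mult mult_left_le)
qed

lemma Metric_space_seq_dist: "Metric_space UNIV seq_dist"
proof
  fix x y z :: "nat \<Rightarrow> real"
  show "0 \<le> seq_dist x y"
    unfolding seq_dist_def by (intro suminf_nonneg summable_seq_dist) simp
  show "seq_dist x y = seq_dist y x"
    by (simp add: seq_dist_def abs_minus_commute)
  show "seq_dist x y = 0 \<longleftrightarrow> x = y"
  proof
    assume "seq_dist x y = 0"
    then have "(1/2) ^ Suc i * min \<bar>x i - y i\<bar> 1 = 0" for i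
      using suminf_eq_zero_iff[OF summable_seq_dist[of x y]] unfolding seq_dist_def by simp
    then have "min \<bar>x i - y i\<bar> 1 = 0" for i
      by (metis divide_eq_0_iff mult_eq_0_iff power_eq_0_iff zero_neq_numeral zero_neq_one)
    then have "x i = y i" for i
      by (metis abs_eq_0 eq_iff_diff_eq_0 min_def zero_neq_one)
    then show "x = y" by blast
  qed (simp add: seq_dist_def)
  show "seq_dist x z \<le> seq_dist x y + seq_dist y z"
    unfolding seq_dist_def suminf_add[OF summable_seq_dist summable_seq_dist]
  proof (intro suminf_le summable_add summable_seq_dist)
    fix i
    have "min \<bar>x i - z i\<bar> 1 \<le> min \<bar>x i - y i\<bar> 1 + min \<bar>y i - z i\<bar> 1"
      by linarith
    then show "(1/2) ^ Suc i * min \<bar>x i - z i\<bar> 1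
      \<le> (1/2) ^ Suc i * min \<bar>x i - y i\<bar> 1 + (1/2) ^ Suc i * min \<bar>y i - z i\<bar> 1"
      by (simp only: distrib_left[symmetric] mult_left_mono zero_le_power
          zero_le_divide_1_iff zero_le_numeral)
  qed
qed

lemma mspace_seq_metric [simp]: "mspace seq_metric = UNIV"
  and mdist_seq_metric [simp]: "mdist seq_metric = seq_dist"
  by (simp_all add: seq_metric_def Metric_space.mspace_metric Metric_space.mdist_metric
      Metric_space_seq_dist)

lemma Metric_space_Rm:
  "Metric_space (topspace (Euclidean_space m)) (\<lambda>x y. L2_set (\<lambda>i. x i - y i) {..<m})"
proof
  fix x y z :: "nat \<Rightarrow> real"
  show "0 \<le> L2_set (\<lambda>i. x i - y i) {..<m}"
    by simp
  show "L2_set (\<lambda>i. x i - y i) {..<m} = L2_set (\<lambda>i. y i - x i) {..<m}"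
    by (simp add: L2_set_def power2_commute)
  show "L2_set (\<lambda>i. x i - z i) {..<m}
      \<le> L2_set (\<lambda>i. x i - y i) {..<m} + L2_set (\<lambda>i. y i - z i) {..<m}"
    using L2_set_triangle_ineq[of "\<lambda>i. x i - y i" "\<lambda>i. y i - z i" "{..<m}"] by simp
  assume "x \<in> topspace (Euclidean_space m)" "y \<in> topspace (Euclidean_space m)"
  then show "L2_set (\<lambda>i. x i - y i) {..<m} = 0 \<longleftrightarrow> x = y"
    by (auto simp: L2_set_eq_0_iff topspace_Euclidean_space fun_eq_iff) (metis lessThan_iff leI)
qed

lemma mspace_Rm_metric [simp]: "mspace (Rm_metric m) = topspace (Euclidean_space m)"
  and mdist_Rm_metric [simp]: "mdist (Rm_metric m) = (\<lambda>x y. L2_set (\<lambda>i. x i - y i) {..<m})"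
  by (simp_all add: Rm_metric_def Metric_space.mspace_metric Metric_space.mdist_metric
      Metric_space_Rm)

section \<open>Ideals\<close>

definition set_ideal :: "'a set \<Rightarrow> 'a set set \<Rightarrow> bool" where
  "set_ideal X S \<longleftrightarrow> S \<subseteq> Pow X \<and> {} \<in> S \<and> (\<forall>A\<in>S. \<forall>B\<in>S. A \<union> B \<in> S) \<and> (\<forall>A\<in>S. \<forall>B. B \<subseteq> A \<longrightarrow> B \<in> S)"

text \<open>Extended real valued, so that the distance to the empty set is infinite.\<close>

definition dist_to_set :: "'a metric \<Rightarrow> 'a \<Rightarrow> 'a set \<Rightarrow> ereal" where
  "dist_to_set X x C = (INF c\<in>C. ereal (mdist X x c))"

definition exclusion_ideal :: "'a metric \<Rightarrow> 'a set \<Rightarrow> 'a set set" where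
  "exclusion_ideal X C =
     \<Inter> {S. set_ideal (mspace X) S \<and>
            (\<forall>r>0. {x \<in> mspace X. dist_to_set X x C \<ge> ereal r} \<in> S)}"

section \<open>Regular variation on an ideal\<close>

definition borel_metric :: "'a metric \<Rightarrow> 'a measure" where
  "borel_metric X = sigma (mspace X) {A. openin (mtopology_of X) A}"

definition ideal_measures :: "'a metric \<Rightarrow> 'a set set \<Rightarrow> 'a measure set" where
  "ideal_measures X S =
     {\<mu>. sets \<mu> = sets (borel_metric X) \<and>
         (\<forall>B \<in> sets \<mu> \<inter> S. emeasure \<mu> B < \<infinity>) \<and>
         (\<forall>B \<in> sets \<mu>. B \<inter> \<Union>S = {} \<longrightarrow> emeasure \<mu> B = 0)}"

text \<open>A test function lives on \<open>\<Union>S\<close> only; it is represented by its extension by zero, which does not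
  change either integral in the definition of regular variation, because \<open>\<mu>\<close> vanishes outside \<open>\<Union>S\<close>.\<close>

definition test_function :: "'a metric \<Rightarrow> 'a set set \<Rightarrow> ('a \<Rightarrow> real) \<Rightarrow> bool" where
  "test_function X S f \<longleftrightarrow>
     continuous_map (subtopology (mtopology_of X) (\<Union>S)) euclideanreal f \<and>
     bounded (f ` \<Union>S) \<and>
     mtopology_of X closure_of {x \<in> \<Union>S. f x \<noteq> 0} \<in> S \<and>
     (\<forall>x. x \<notin> \<Union>S \<longrightarrow> f x = 0)"

text \<open>Only the values of \<open>g\<close> on \<open>[0,\<infinity>)\<close> matter. The random element \<open>\<xi>\<close> is defined on the probability
  space \<open>P\<close>, and \<open>T\<close> is the scaling.\<close>

definition RV :: "'a metric \<Rightarrow> (real \<Rightarrow> 'a \<Rightarrow> 'a) \<Rightarrow> 'a set set \<Rightarrow> (real \<Rightarrow> real) \<Rightarrow> 'a measure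
    \<Rightarrow> 'w measure \<Rightarrow> ('w \<Rightarrow> 'a) \<Rightarrow> bool" where
  "RV X T S g \<mu> P \<xi> \<longleftrightarrow>
     g \<in> borel_measurable (restrict_space borel {0..}) \<and>
     (\<forall>t\<ge>0. g t \<ge> 0) \<and>
     filterlim g at_top at_top \<and>
     \<mu> \<in> ideal_measures X S \<and>
     (\<exists>B \<in> sets \<mu> \<inter> S. emeasure \<mu> B > 0) \<and>
     (\<forall>f. test_function X S f \<longrightarrow>
       ((\<lambda>t. g t * (\<integral>\<omega>. f (T (inverse t) (\<xi> \<omega>)) \<partial>P)) \<longlongrightarrow> (\<integral>x. f x \<partial>\<mu>)) at_top)"

end

theory Submission
  imports Defs
begin

text \<open>A set lies in the ideal obtained by excluding \<open>C\<close> exactly when it is contained in some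
  \<open>far_set M C r\<close> with \<open>r > 0\<close>, the set of points at distance at least \<open>r\<close> from \<open>C\<close>. For sequences the
  distance \<open>seq_dist\<close> and the Euclidean distance of the first \<open>m\<close> coordinates control each other up to
  the total weight \<open>2\<^sup>-\<^sup>m\<close> of the remaining coordinates. Hence preimages under \<open>seq_proj m\<close> of ideal sets
  are ideal sets (\<open>pulls_back_far_seq\<close>), and conversely every ideal set of sequences is contained in such
  a preimage as soon as \<open>m\<close> is large (\<open>far_seq_imp_far_Rm\<close>). The ideal on sequences is thus the
  projective limit of the ideals on the finite-dimensional spaces, and the theorem says that regular
  variation respects this limit.

  From sequences to vectors this is a continuous mapping argument: composing a test function with the
  projection gives a test function, so the image measure, restricted to the union of the ideal, is the
  limit measure (\<open>scaled_law_tendsto_distr\<close>). Since test functions determine a measure on the ideal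
  (\<open>test_functions_determine\<close>), limit measures are unique there, which is the claim on \<open>\<mu>\<^sub>m\<close>; the same
  uniqueness makes the measures \<open>\<mu>\<^sub>m\<close> consistent when they are the given objects.

  From vectors to sequences, the limit measure has to be constructed. The measures \<open>\<mu>\<^sub>m\<close> may be
  infinite near \<open>C\<close>, so the Kolmogorov extension theorem does not apply to them directly. The complement
  of the closure of \<open>C\<close> is instead cut into countably many disjoint layers, each of them a cylinder in
  the ideal. On one layer the \<open>\<mu>\<^sub>m\<close> form a consistent family of finite measures of equal mass and
  extend to a measure on sequences; the sum over the layers is the measure wanted
  (\<open>consistent_measures.extension\<close>).

  Convergence to this measure is known for test functions that depend on finitely many coordinates. A
  nonnegative continuous function \<open>F\<close> is the pointwise limit of minorants of this kind, namely
  \<open>f\<^sub>k x = (INF y. F y + k * d (seq_proj k x) (seq_proj k y))\<close>, which gives the lower bound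
  \<open>liminf g(t) E F(\<xi>/t) \<ge> \<integral>F d\<mu>\<close> by dominated convergence (\<open>nonneg_lower_bound\<close>). For a test function
  \<open>f\<close> bounded by \<open>K\<close> there is a test function \<open>h\<close> of finitely many coordinates that equals 1 on the support
  of \<open>f\<close>. The lower bound for \<open>K h + f\<close> and for \<open>K h - f\<close>, together with the convergence already known for
  \<open>h\<close>, gives the convergence for \<open>f\<close>.\<close>

section \<open>Exclusion ideals and their test functions\<close>

text \<open>For empty \<open>C\<close> this is the whole space for every \<open>r\<close>, in accordance with an infinite distance to the
  empty set.\<close>

definition far_set :: "'a metric \<Rightarrow> 'a set \<Rightarrow> real \<Rightarrow> 'a set" where
  "far_set M C r = {x \<in> mspace M. \<forall>c\<in>C. r \<le> mdist M x c}"

lemma far_set_subset: "far_set M C r \<subseteq> mspace M"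
  by (auto simp: far_set_def)

lemma far_set_antimono: "r \<le> s \<Longrightarrow> far_set M C s \<subseteq> far_set M C r"
  by (force simp: far_set_def)

lemma dist_to_set_ge_iff: "ereal r \<le> dist_to_set M x C \<longleftrightarrow> (\<forall>c\<in>C. r \<le> mdist M x c)"
  by (simp add: dist_to_set_def le_INF_iff)

text \<open>The subsets of far sets already form an ideal: two far sets lie in the one with the smaller radius.\<close>

lemma exclusion_ideal_iff:
  "A \<in> exclusion_ideal M C \<longleftrightarrow> (\<exists>r>0. A \<subseteq> far_set M C r)"
proof
  have eq: "{x \<in> mspace M. dist_to_set M x C \<ge> ereal r} = far_set M C r" for r
    by (auto simp: far_set_def dist_to_set_ge_iff)
  let ?S = "{A. \<exists>r>0. A \<subseteq> far_set M C r}"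
  have "set_ideal (mspace M) ?S"
    unfolding set_ideal_def
  proof (intro conjI ballI allI impI)
    show "?S \<subseteq> Pow (mspace M)"
      using far_set_subset[of M C] by blast
    show "{} \<in> ?S"
      by (auto intro: exI[of _ 1])
  next
    fix A B assume "A \<in> ?S" "B \<in> ?S"
    then obtain r s where "r > 0" "A \<subseteq> far_set M C r" "s > 0" "B \<subseteq> far_set M C s"
      by blast
    then have "A \<union> B \<subseteq> far_set M C (min r s)" "min r s > 0"
      using far_set_antimono[of "min r s" r M C] far_set_antimono[of "min r s" s M C] by auto
    then show "A \<union> B \<in> ?S" by blast
  next
    fix A B assume "A \<in> ?S" "B \<subseteq> A"
    then show "B \<in> ?S" by auto
  qed
  moreover have "\<forall>r>0. {x \<in> mspace M. dist_to_set M x C \<ge> ereal r} \<in> ?S"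
    unfolding eq by blast
  moreover assume "A \<in> exclusion_ideal M C"
  ultimately show "\<exists>r>0. A \<subseteq> far_set M C r"
    unfolding exclusion_ideal_def by blast
next
  assume "\<exists>r>0. A \<subseteq> far_set M C r"
  then obtain r where r: "r > 0" "A \<subseteq> far_set M C r" by blast
  have eq: "{x \<in> mspace M. dist_to_set M x C \<ge> ereal r} = far_set M C r"
    by (auto simp: far_set_def dist_to_set_ge_iff)
  show "A \<in> exclusion_ideal M C"
    unfolding exclusion_ideal_def
  proof (rule InterI, elim CollectE conjE)
    fix S assume S: "set_ideal (mspace M) S"
      and "\<forall>r>0. {x \<in> mspace M. dist_to_set M x C \<ge> ereal r} \<in> S"
    then have "far_set M C r \<in> S"
      using r(1) eq by metis
    then show "A \<in> S"
      using S r(2) unfolding set_ideal_def by blast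
  qed
qed

lemma Union_exclusion_ideal: "\<Union>(exclusion_ideal M C) = (\<Union>r\<in>{0<..}. far_set M C r)"
  using exclusion_ideal_iff[of _ M C] by fast

lemma ball_in_far_set:
  assumes "x \<in> far_set M C r" "C \<subseteq> mspace M" "y \<in> mspace M" "mdist M x y \<le> e"
  shows "y \<in> far_set M C (r - e)"
proof -
  interpret Metric_space "mspace M" "mdist M" by blast
  have "r - e \<le> mdist M y c" if "c \<in> C" for c
  proof -
    have "r \<le> mdist M x c" "c \<in> mspace M" "x \<in> mspace M"
      using assms that by (auto simp: far_set_def)
    then show ?thesis
      using triangle[of x y c] assms by simp
  qed
  then show ?thesis
    using assms by (simp add: far_set_def)
qed

text \<open>Between two far sets there is an open set, which makes room for continuous cut-offs.\<close>

lemma far_set_interior: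
  assumes "C \<subseteq> mspace M" "s < r"
  obtains U where "openin (mtopology_of M) U" "far_set M C r \<subseteq> U" "U \<subseteq> far_set M C s"
proof
  interpret Metric_space "mspace M" "mdist M" by blast
  let ?U = "{y \<in> mspace M. \<exists>q>s. y \<in> far_set M C q}"
  show "openin (mtopology_of M) ?U"
    unfolding mtopology_of_def openin_mtopology
  proof (intro conjI allI impI)
    fix x assume "x \<in> ?U"
    then obtain q where q: "q > s" "x \<in> far_set M C q" by blast
    have "mball x ((q - s)/2) \<subseteq> ?U"
    proof
      fix y assume "y \<in> mball x ((q - s)/2)"
      then have "y \<in> far_set M C (q - (q-s)/2)" "y \<in> mspace M"
        using ball_in_far_set[OF q(2) assms(1), of y "(q-s)/2"] by auto
      moreover have "q - (q-s)/2 > s" using q(1) by (simp add: field_simps)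
      ultimately show "y \<in> ?U" by blast
    qed
    then show "\<exists>e>0. mball x e \<subseteq> ?U"
      using q(1) by (intro exI[of _ "(q-s)/2"]) auto
  qed blast
  show "far_set M C r \<subseteq> ?U"
    using assms(2) far_set_subset[of M C r] by blast
  show "?U \<subseteq> far_set M C s"
  proof
    fix y assume "y \<in> ?U"
    then obtain q where "q > s" "y \<in> far_set M C q" by blast
    then show "y \<in> far_set M C s"
      using far_set_antimono[of s q M C] by auto
  qed
qed

lemma closedin_far_set:
  assumes "C \<subseteq> mspace M"
  shows "closedin (mtopology_of M) (far_set M C r)"
proof -
  interpret Metric_space "mspace M" "mdist M" by blast
  have "far_set M C r = mspace M - (\<Union>c\<in>C. mball c r)"
    using assms by (auto simp: far_set_def commute not_less subset_iff)
  moreover have "openin (mtopology_of M) (\<Union>c\<in>C. mball c r)"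
    unfolding mtopology_of_def by (intro openin_Union) auto
  ultimately show ?thesis
    by (metis closedin_def openin_closedin_eq topspace_mtopology_of closedin_topspace closedin_diff)
qed

lemma test_functionI:
  assumes C: "C \<subseteq> mspace M"
    and cont: "continuous_map (mtopology_of M) euclideanreal f"
    and bdd: "\<And>x. x \<in> mspace M \<Longrightarrow> \<bar>f x\<bar> \<le> K"
    and r: "r > 0" and supp: "\<And>x. f x \<noteq> 0 \<Longrightarrow> x \<in> far_set M C r"
  shows "test_function M (exclusion_ideal M C) f"
  unfolding test_function_def
proof (intro conjI allI impI)
  have sub: "\<Union>(exclusion_ideal M C) \<subseteq> mspace M"
    unfolding Union_exclusion_ideal using far_set_subset[of M C] by blast
  show "continuous_map (subtopology (mtopology_of M) (\<Union>(exclusion_ideal M C))) euclideanreal f"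
    using cont by (rule continuous_map_from_subtopology)
  show "bounded (f ` \<Union>(exclusion_ideal M C))"
    unfolding bounded_iff using bdd sub by (auto intro!: exI[of _ K])
  have "mtopology_of M closure_of {x \<in> \<Union>(exclusion_ideal M C). f x \<noteq> 0} \<subseteq> far_set M C r"
    by (rule closure_of_minimal[OF _ closedin_far_set[OF C]]) (use supp in auto)
  then show "mtopology_of M closure_of {x \<in> \<Union>(exclusion_ideal M C). f x \<noteq> 0} \<in> exclusion_ideal M C"
    unfolding exclusion_ideal_iff using r by blast
  show "f x = 0" if "x \<notin> \<Union>(exclusion_ideal M C)" for x
    using that supp[of x] r unfolding Union_exclusion_ideal by auto
qed

text \<open>A test function is given by its continuity on the union of the ideal only. Its extension by zero is
  continuous on the whole space, because its support keeps a positive distance from \<open>C\<close>. This turns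
  test functions into ordinary bounded continuous functions.\<close>

lemma test_functionE:
  assumes C: "C \<subseteq> mspace M" and f: "test_function M (exclusion_ideal M C) f"
  obtains K r where "continuous_map (mtopology_of M) euclideanreal f"
    "K > 0" "\<And>x. \<bar>f x\<bar> \<le> K" "r > 0" "\<And>x. f x \<noteq> 0 \<Longrightarrow> x \<in> far_set M C r"
proof -
  let ?X = "mtopology_of M" let ?U = "\<Union>(exclusion_ideal M C)"
  have fU: "continuous_map (subtopology ?X ?U) euclideanreal f"
    and bdd: "bounded (f ` ?U)"
    and cl: "?X closure_of {x \<in> ?U. f x \<noteq> 0} \<in> exclusion_ideal M C"
    and z: "\<And>x. x \<notin> ?U \<Longrightarrow> f x = 0"
    using f by (auto simp: test_function_def)
  obtain r where r: "r > 0" "?X closure_of {x \<in> ?U. f x \<noteq> 0} \<subseteq> far_set M C r"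
    using cl by (auto simp: exclusion_ideal_iff)
  obtain K where K: "K > 0" "\<And>x. x \<in> ?U \<Longrightarrow> \<bar>f x\<bar> \<le> K"
    using bdd by (auto simp: bounded_pos)
  have "?U \<subseteq> topspace ?X"
    unfolding Union_exclusion_ideal using far_set_subset[of M C] by auto
  then have supp: "x \<in> far_set M C r" if "f x \<noteq> 0" for x
    using that z[of x] r(2) closure_of_subset[of "{x \<in> ?U. f x \<noteq> 0}" ?X] by blast
  have bdd': "\<bar>f x\<bar> \<le> K" for x
    using K z[of x] by (cases "x \<in> ?U") auto
  \<comment> \<open>\<open>f\<close> is continuous on an open set around the support and vanishes on the open complement of the
    support, and these two open sets cover the space.\<close>
  obtain V where V: "openin ?X V" "far_set M C r \<subseteq> V" "V \<subseteq> far_set M C (r/2)"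
    using far_set_interior[OF C, of "r/2" r] r(1) by auto
  have VU: "V \<subseteq> ?U"
    using V(3) r(1) unfolding Union_exclusion_ideal by (force intro: half_gt_zero)
  have "continuous_map ?X euclideanreal f"
  proof (rule pasting_lemma[where T = "\<lambda>b. if b then V else mspace M - far_set M C r" and f = "\<lambda>b. f"
        and I = UNIV])
    fix b :: bool
    show "openin ?X (if b then V else mspace M - far_set M C r)"
      using V(1) closedin_far_set[OF C, of r] by (auto simp: closedin_def)
    have "continuous_map (subtopology ?X V) euclideanreal f"
      using fU VU by (metis continuous_map_from_subtopology_mono)
    moreover have "continuous_map (subtopology ?X (mspace M - far_set M C r)) euclideanreal f"
      by (rule continuous_map_eq[where f = "\<lambda>_. 0"]) (use supp in auto)
    ultimately show "continuous_map (subtopology ?X (if b then V else mspace M - far_set M C r)) euclideanreal f"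
      by auto
  next
    fix x assume "x \<in> topspace ?X"
    then show "\<exists>j. j \<in> UNIV \<and> x \<in> (if j then V else mspace M - far_set M C r) \<and> f x = f x"
      using V(2) by (cases "x \<in> far_set M C r") (auto intro: exI[of _ True] exI[of _ False])
  qed auto
  then show thesis
    using K(1) bdd' r(1) supp by (rule that)
qed

section \<open>Lipschitz approximation from below\<close>

text \<open>The Pasch-Hausdorff envelope of \<open>F\<close>, with the distance measured after the map \<open>p k\<close>. For nonexpansive
  \<open>p k\<close> it is a \<open>k\<close>-Lipschitz minorant of \<open>F\<close> that sees \<open>x\<close> only through \<open>p k x\<close>. With \<open>p k\<close> the identity it
  approximates indicators of open sets by test functions; with \<open>p k = seq_proj k\<close> it approximates
  continuous functions of sequences by functions of finitely many coordinates.\<close>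

definition envelope :: "'a metric \<Rightarrow> (nat \<Rightarrow> 'a \<Rightarrow> 'a) \<Rightarrow> ('a \<Rightarrow> real) \<Rightarrow> nat \<Rightarrow> 'a \<Rightarrow> real" where
  "envelope M p F k x = (INF y\<in>mspace M. F y + real k * mdist M (p k x) (p k y))"

context
  fixes M :: "'a metric" and p :: "nat \<Rightarrow> 'a \<Rightarrow> 'a" and F :: "'a \<Rightarrow> real"
  assumes p: "\<And>k x. x \<in> mspace M \<Longrightarrow> p k x \<in> mspace M"
    and F0: "\<And>x. x \<in> mspace M \<Longrightarrow> 0 \<le> F x"
begin

lemma envelope_bdd_below: "bdd_below ((\<lambda>y. F y + real k * mdist M (p k x) (p k y)) ` mspace M)"
  by (rule bdd_belowI2[of _ 0]) (simp add: F0)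

lemma envelope_nonneg:
  assumes "x \<in> mspace M"
  shows "0 \<le> envelope M p F k x"
  unfolding envelope_def using assms by (intro cINF_greatest) (auto simp: F0)

lemma envelope_le:
  assumes "y \<in> mspace M"
  shows "envelope M p F k x \<le> F y + real k * mdist M (p k x) (p k y)"
  unfolding envelope_def by (intro cINF_lower envelope_bdd_below assms)

lemma envelope_le_fibre:
  assumes "x \<in> mspace M" "y \<in> mspace M" "p k x = p k y"
  shows "envelope M p F k x \<le> F y"
proof -
  have "mdist M (p k x) (p k y) = 0"
    using Metric_space.mdist_zero[OF Metric_space_mspace_mdist p[OF assms(2)]] assms(3) by simp
  then show ?thesis
    using envelope_le[OF assms(2), of k x] by simp
qed

lemma envelope_le_self: "x \<in> mspace M \<Longrightarrow> envelope M p F k x \<le> F x"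
  by (rule envelope_le_fibre) auto

lemma envelope_Lipschitz:
  assumes nonexp: "\<And>x y. x \<in> mspace M \<Longrightarrow> y \<in> mspace M \<Longrightarrow> mdist M (p k x) (p k y) \<le> mdist M x y"
    and x: "x \<in> mspace M" and x': "x' \<in> mspace M"
  shows "envelope M p F k x \<le> envelope M p F k x' + real k * mdist M x x'"
proof -
  interpret Metric_space "mspace M" "mdist M" by blast
  have "envelope M p F k x - real k * mdist M x x' \<le> envelope M p F k x'"
    unfolding envelope_def[of M p F k x']
  proof (rule cINF_greatest)
    fix y assume y: "y \<in> mspace M"
    have "mdist M (p k x) (p k y) \<le> mdist M x x' + mdist M (p k x') (p k y)"
      using triangle[of "p k x" "p k x'" "p k y"] nonexp[OF x x'] p x x' y by fastforce
    then have "real k * mdist M (p k x) (p k y) \<le> real k * mdist M x x' + real k * mdist M (p k x') (p k y)"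
      by (metis distrib_left mult_left_mono of_nat_0_le_iff)
    then show "envelope M p F k x - real k * mdist M x x' \<le> F y + real k * mdist M (p k x') (p k y)"
      using envelope_le[OF y, of k x] by simp
  qed (use x in auto)
  then show ?thesis by simp
qed

lemma envelope_continuous:
  assumes "\<And>x y. x \<in> mspace M \<Longrightarrow> y \<in> mspace M \<Longrightarrow> mdist M (p k x) (p k y) \<le> mdist M x y"
  shows "continuous_map (mtopology_of M) euclideanreal (envelope M p F k)"
proof -
  interpret Metric_space "mspace M" "mdist M" by blast
  have "Lipschitz_continuous_map M euclidean_metric (envelope M p F k)"
    unfolding Lipschitz_continuous_map_def
  proof (intro conjI exI ballI)
    fix x y assume "x \<in> mspace M" "y \<in> mspace M"
    then show "mdist euclidean_metric (envelope M p F k x) (envelope M p F k y) \<le> real k * mdist M x y"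
      using envelope_Lipschitz[OF assms, of x y] envelope_Lipschitz[OF assms, of y x]
      by (simp add: dist_real_def commute abs_le_iff)
  qed auto
  from Lipschitz_continuous_imp_continuous_map[OF this] show ?thesis
    by simp
qed

text \<open>Points outside a ball around \<open>x\<close> on which \<open>F\<close> exceeds \<open>a\<close> do not affect the infimum below
  level \<open>a\<close> once the penalty \<open>k\<close> is large, so lower semicontinuity is all that convergence
  requires.\<close>

lemma envelope_tendsto:
  assumes eps: "\<And>k x y. x \<in> mspace M \<Longrightarrow> y \<in> mspace M \<Longrightarrow> mdist M x y \<le> mdist M (p k x) (p k y) + \<epsilon> k"
    and eps0: "\<epsilon> \<longlonglongrightarrow> 0"
    and lsc: "\<And>a. openin (mtopology_of M) {x \<in> mspace M. a < F x}"
    and x: "x \<in> mspace M"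
  shows "(\<lambda>k. envelope M p F k x) \<longlonglongrightarrow> F x"
proof (rule order_tendstoI)
  fix a assume "F x < a"
  then show "\<forall>\<^sub>F k in sequentially. envelope M p F k x < a"
    by (intro always_eventually allI le_less_trans[OF envelope_le_self[OF x]])
next
  interpret Metric_space "mspace M" "mdist M" by blast
  fix b assume "b < F x"
  then obtain a where a: "b < a" "a < F x" using dense by blast
  then obtain \<delta> where \<delta>: "\<delta> > 0" "mball x \<delta> \<subseteq> {x \<in> mspace M. a < F x}"
  proof -
    have "openin mtopology {x \<in> mspace M. a < F x}"
      using lsc[of a] by (simp add: mtopology_of_def)
    then have "\<exists>\<delta>>0. mball x \<delta> \<subseteq> {x \<in> mspace M. a < F x}"
      using a(2) x unfolding openin_mtopology by simp
    then show ?thesis using that by auto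
  qed
  obtain N where N: "2 * a / \<delta> \<le> real N"
    using real_arch_simple by blast
  have "\<forall>\<^sub>F k in sequentially. \<epsilon> k < \<delta> / 2"
    using order_tendstoD(2)[OF eps0, of "\<delta>/2"] \<delta>(1) by simp
  then show "\<forall>\<^sub>F k in sequentially. b < envelope M p F k x"
    using eventually_ge_at_top[of N]
  proof eventually_elim
    case (elim k)
    have "a \<le> envelope M p F k x"
      unfolding envelope_def
    proof (rule cINF_greatest)
      fix y assume y: "y \<in> mspace M"
      show "a \<le> F y + real k * mdist M (p k x) (p k y)"
      proof (cases "y \<in> mball x \<delta>")
        case True
        then have "a < F y" using \<delta>(2) by blast
        then show ?thesis by (simp add: add_increasing2)
      next
        case False
        then have "\<delta> / 2 \<le> mdist M (p k x) (p k y)"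
          using eps[OF x y, of k] elim x y by simp
        then have "real k * (\<delta> / 2) \<le> real k * mdist M (p k x) (p k y)"
          by (rule mult_left_mono) simp
        moreover have "a \<le> real k * (\<delta> / 2)"
        proof -
          have "2 * a / \<delta> \<le> real k"
            using N elim(2) by (meson of_nat_le_iff order_trans)
          then show ?thesis
            using \<delta>(1) by (simp add: divide_le_eq)
        qed
        ultimately show ?thesis
          using F0[OF y] by simp
      qed
    qed (use x in auto)
    then show ?case using a(1) by simp
  qed
qed

end

section \<open>Borel measures that are finite away from the excluded set\<close>

lemma space_borel_metric [simp]: "space (borel_metric M) = mspace M"
  unfolding borel_metric_def
  by (rule space_measure_of) (use openin_subset[of "mtopology_of M"] in auto)

lemma sets_borel_metric:
  "sets (borel_metric M) = sigma_sets (mspace M) {A. openin (mtopology_of M) A}"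
  unfolding borel_metric_def
  by (rule sets_measure_of) (use openin_subset[of "mtopology_of M"] in auto)

lemma openin_sets_borel_metric: "openin (mtopology_of M) A \<Longrightarrow> A \<in> sets (borel_metric M)"
  by (simp add: sets_borel_metric sigma_sets.Basic)

lemma closedin_sets_borel_metric:
  assumes "closedin (mtopology_of M) A"
  shows "A \<in> sets (borel_metric M)"
proof -
  have "mspace M - (mspace M - A) \<in> sets (borel_metric M)"
    using assms sets.compl_sets[of "mspace M - A" "borel_metric M"]
    by (auto intro: openin_sets_borel_metric simp: closedin_def)
  moreover have "mspace M - (mspace M - A) = A"
    using closedin_subset[OF assms] by auto
  ultimately show ?thesis by simp
qed

lemma far_set_sets: "C \<subseteq> mspace M \<Longrightarrow> far_set M C r \<in> sets (borel_metric M)"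
  by (intro closedin_sets_borel_metric closedin_far_set)

lemma measurable_borel_metric_continuous_map:
  assumes "continuous_map (mtopology_of M) (mtopology_of N) p"
  shows "p \<in> borel_metric M \<rightarrow>\<^sub>M borel_metric N"
  unfolding borel_metric_def[of N]
proof (rule measurable_measure_of)
  show "{A. openin (mtopology_of N) A} \<subseteq> Pow (mspace N)"
    using openin_subset[of "mtopology_of N"] by auto
  show "p \<in> space (borel_metric M) \<rightarrow> mspace N"
    using assms by (auto simp: continuous_map_def)
  fix A assume "A \<in> {A. openin (mtopology_of N) A}"
  then have "openin (mtopology_of M) {x \<in> topspace (mtopology_of M). p x \<in> A}"
    using assms by (auto simp: continuous_map_def)
  then show "p -` A \<inter> space (borel_metric M) \<in> sets (borel_metric M)"
    by (intro openin_sets_borel_metric) (simp add: vimage_def Int_def conj_commute)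
qed

lemma borel_measurable_continuous_map:
  assumes "continuous_map (mtopology_of M) euclidean f"
  shows "f \<in> borel_measurable (borel_metric M)"
proof (rule borel_measurableI)
  fix S :: "'b set" assume "open S"
  then have "openin (mtopology_of M) {x \<in> topspace (mtopology_of M). f x \<in> S}"
    using assms by (auto simp: continuous_map_def)
  then show "f -` S \<inter> space (borel_metric M) \<in> sets (borel_metric M)"
    by (intro openin_sets_borel_metric) (simp add: vimage_def Int_def conj_commute)
qed

text \<open>Membership in \<^const>\<open>ideal_measures\<close> without the requirement to vanish outside the union of the
  ideal. An image measure satisfies this condition but need not vanish there, since the projection may
  carry points outside \<open>C\<close> into the closure of the projected cone.\<close>

definition finite_away :: "'a metric \<Rightarrow> 'a set \<Rightarrow> 'a measure \<Rightarrow> bool" where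
  "finite_away M C \<mu> \<longleftrightarrow>
     sets \<mu> = sets (borel_metric M) \<and> (\<forall>r>0. emeasure \<mu> (far_set M C r) < \<infinity>)"

lemma finite_away_sets: "finite_away M C \<mu> \<Longrightarrow> sets \<mu> = sets (borel_metric M)"
  by (simp add: finite_away_def)

lemma finite_away_finite: "finite_away M C \<mu> \<Longrightarrow> r > 0 \<Longrightarrow> emeasure \<mu> (far_set M C r) < \<infinity>"
  by (simp add: finite_away_def)

lemma ideal_measures_iff:
  assumes C: "C \<subseteq> mspace M"
  shows "\<mu> \<in> ideal_measures M (exclusion_ideal M C) \<longleftrightarrow>
    finite_away M C \<mu> \<and> (\<forall>B\<in>sets \<mu>. (\<forall>r>0. B \<inter> far_set M C r = {}) \<longrightarrow> emeasure \<mu> B = 0)"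
proof -
  have "(\<forall>B \<in> sets \<mu> \<inter> exclusion_ideal M C. emeasure \<mu> B < \<infinity>) \<longleftrightarrow>
      (\<forall>r>0. emeasure \<mu> (far_set M C r) < \<infinity>)" if "sets \<mu> = sets (borel_metric M)"
  proof (intro iffI ballI allI impI)
    fix r :: real assume "\<forall>B \<in> sets \<mu> \<inter> exclusion_ideal M C. emeasure \<mu> B < \<infinity>" "r > 0"
    moreover have "far_set M C r \<in> exclusion_ideal M C"
      unfolding exclusion_ideal_iff using \<open>r > 0\<close> by blast
    ultimately show "emeasure \<mu> (far_set M C r) < \<infinity>"
      using far_set_sets[OF C] that by blast
  next
    fix B assume fin: "\<forall>r>0. emeasure \<mu> (far_set M C r) < \<infinity>" and B: "B \<in> sets \<mu> \<inter> exclusion_ideal M C"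
    then obtain r where r: "r > 0" "B \<subseteq> far_set M C r"
      by (auto simp: exclusion_ideal_iff)
    then have "emeasure \<mu> B \<le> emeasure \<mu> (far_set M C r)"
      using far_set_sets[OF C] that by (intro emeasure_mono) auto
    then show "emeasure \<mu> B < \<infinity>"
      using fin r(1) le_less_trans by blast
  qed
  moreover have "B \<inter> \<Union>(exclusion_ideal M C) = {} \<longleftrightarrow> (\<forall>r>0. B \<inter> far_set M C r = {})" for B
    unfolding Union_exclusion_ideal by auto
  ultimately show ?thesis
    unfolding ideal_measures_def finite_away_def by auto
qed

lemma test_function_integrable:
  assumes C: "C \<subseteq> mspace M" and f: "test_function M (exclusion_ideal M C) f"
    and \<mu>: "finite_away M C \<mu>"
  shows "integrable \<mu> f"
proof -
  obtain K r where K: "continuous_map (mtopology_of M) euclideanreal f"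
    "K > 0" "\<And>x. \<bar>f x\<bar> \<le> K" "r > 0" "\<And>x. f x \<noteq> 0 \<Longrightarrow> x \<in> far_set M C r"
    using test_functionE[OF C f] by metis
  have f: "f \<in> borel_measurable \<mu>"
    using borel_measurable_continuous_map[OF K(1)] finite_away_sets[OF \<mu>] measurable_cong_sets by blast
  show ?thesis
    by (rule integrableI_bounded_set[where A = "far_set M C r" and B = K])
      (use K f finite_away_finite[OF \<mu>] finite_away_sets[OF \<mu>] far_set_sets[OF C] in auto)
qed

text \<open>Both integrals are integrals against the restrictions of the measures to \<open>A\<close>, and these agree.\<close>

lemma integral_cong_on_support:
  fixes f :: "'a \<Rightarrow> real"
  assumes sets: "sets \<mu> = sets \<nu>" and A: "A \<in> sets \<mu>"
    and eq: "\<And>B. B \<in> sets \<mu> \<Longrightarrow> B \<subseteq> A \<Longrightarrow> emeasure \<mu> B = emeasure \<nu> B"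
    and f: "f \<in> borel_measurable \<mu>" and supp: "\<And>x. f x \<noteq> 0 \<Longrightarrow> x \<in> A"
  shows "(\<integral>x. f x \<partial>\<mu>) = (\<integral>x. f x \<partial>\<nu>)"
proof -
  have *: "(\<integral>x. f x \<partial>\<kappa>) = (\<integral>x. f x \<partial>density \<kappa> (indicator A))" if "sets \<kappa> = sets \<mu>" for \<kappa>
  proof -
    have [measurable]: "f \<in> borel_measurable \<kappa>" "A \<in> sets \<kappa>"
      using f A that measurable_cong_sets by blast+
    have "(\<integral>x. f x \<partial>density \<kappa> (\<lambda>x. ennreal (indicator A x))) = (\<integral>x. indicator A x *\<^sub>R f x \<partial>\<kappa>)"
      by (rule integral_density) auto
    also have "\<dots> = (\<integral>x. f x \<partial>\<kappa>)"
      using supp by (intro Bochner_Integration.integral_cong) (auto simp: indicator_def)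
    finally show ?thesis by (simp add: ennreal_indicator)
  qed
  have "density \<mu> (indicator A) = density \<nu> (indicator A)"
  proof (rule measure_eqI)
    fix B assume "B \<in> sets (density \<mu> (indicator A))"
    then have "B \<in> sets \<mu>" "B \<in> sets \<nu>" "A \<in> sets \<nu>" using sets A by auto
    then show "emeasure (density \<mu> (indicator A)) B = emeasure (density \<nu> (indicator A)) B"
      using A eq[of "A \<inter> B"] by (simp add: emeasure_restricted)
  qed (simp add: sets)
  then show ?thesis
    using *[of \<mu>] *[of \<nu>] sets by simp
qed

text \<open>For \<open>k > 0\<close> and \<open>x \<in> S\<close> this is the minimum of 1 and \<open>k\<close> times the distance from \<open>x\<close> to the complement
  of \<open>S\<close>. As an envelope it inherits continuity and, for open \<open>S\<close>, the limit for growing \<open>k\<close>.\<close>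

definition bump :: "'a metric \<Rightarrow> 'a set \<Rightarrow> nat \<Rightarrow> 'a \<Rightarrow> real" where
  "bump M S k x = (if x \<in> mspace M then envelope M (\<lambda>_ x. x) (indicator S) k x else 0)"

lemma bump_nonneg: "0 \<le> bump M S k x"
  using envelope_nonneg[of M "\<lambda>_ x. x" "indicator S" x k] by (auto simp: bump_def)

lemma bump_le_indicator: "bump M S k x \<le> indicator S x"
  using envelope_le_self[of M "\<lambda>_ x. x" "indicator S" x k] by (auto simp: bump_def)

lemma bump_le_1: "bump M S k x \<le> 1"
  using bump_le_indicator indicator_le_1 by (rule order_trans)

lemma bump_test_function:
  assumes C: "C \<subseteq> mspace M" and r: "r > 0" and S: "S \<subseteq> far_set M C r"
  shows "test_function M (exclusion_ideal M C) (bump M S k)"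
proof (rule test_functionI[OF C _ _ r, where K = 1])
  have "continuous_map (mtopology_of M) euclideanreal (envelope M (\<lambda>_ x. x) (indicator S) k)"
    by (rule envelope_continuous) auto
  then show "continuous_map (mtopology_of M) euclideanreal (bump M S k)"
    by (rule continuous_map_eq) (simp add: bump_def)
  show "\<bar>bump M S k x\<bar> \<le> 1" for x
    using bump_nonneg[of M S k x] bump_le_1[of M S k x] by simp
  show "x \<in> far_set M C r" if "bump M S k x \<noteq> 0" for x
    using that bump_nonneg[of M S k x] bump_le_indicator[of M S k x] S by (cases "x \<in> S") auto
qed

text \<open>The indicator of an open set lying away from \<open>C\<close> is the limit of its bumps, and these are test
  functions. So the measures agree on such open sets, and these generate the Borel sets on an open
  neighbourhood of \<open>B\<close>.\<close>

lemma test_functions_determine: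
  assumes C: "C \<subseteq> mspace M" and \<mu>: "finite_away M C \<mu>" and \<nu>: "finite_away M C \<nu>"
    and eq: "\<And>f. test_function M (exclusion_ideal M C) f \<Longrightarrow> (\<integral>x. f x \<partial>\<mu>) = (\<integral>x. f x \<partial>\<nu>)"
    and B: "B \<in> sets (borel_metric M)" and r: "r > 0" "B \<subseteq> far_set M C r"
  shows "emeasure \<mu> B = emeasure \<nu> B"
proof -
  obtain W where W: "openin (mtopology_of M) W" "far_set M C r \<subseteq> W" "W \<subseteq> far_set M C (r/2)"
    using far_set_interior[OF C, of "r/2" r] r(1) by auto
  have W_sets: "W \<in> sets (borel_metric M)"
    using W(1) by (rule openin_sets_borel_metric)
  have fin: "emeasure \<kappa> G \<noteq> \<infinity>" if "finite_away M C \<kappa>" "G \<subseteq> W" for \<kappa> G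
  proof -
    have "emeasure \<kappa> G \<le> emeasure \<kappa> (far_set M C (r/2))"
      using that W(3) far_set_sets[OF C] finite_away_sets[OF that(1)] by (intro emeasure_mono) auto
    also have "\<dots> < \<infinity>"
      using finite_away_finite[OF that(1)] r(1) by simp
    finally show ?thesis by simp
  qed
  have open_eq: "emeasure \<mu> G = emeasure \<nu> G" if G: "openin (mtopology_of M) G" "G \<subseteq> W" for G
  proof -
    let ?\<phi> = "bump M G"
    have G_sets: "G \<in> sets (borel_metric M)"
      using G(1) by (rule openin_sets_borel_metric)
    have G_sub: "G \<subseteq> mspace M"
      using openin_subset[OF G(1)] by simp
    have \<phi>_test: "test_function M (exclusion_ideal M C) (?\<phi> k)" for k
      using r(1) G(2) W(3) by (intro bump_test_function[OF C, of "r/2"]) auto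
    have lim: "(\<lambda>k. ?\<phi> k x) \<longlonglongrightarrow> indicator G x" for x
    proof (cases "x \<in> mspace M")
      case True
      have "openin (mtopology_of M) {x \<in> mspace M. a < (indicator G x :: real)}" for a
      proof -
        consider "a < 0" | "0 \<le> a" "a < 1" | "1 \<le> a" by linarith
        then show ?thesis
        proof cases
          case 1
          then have "{x \<in> mspace M. a < (indicator G x :: real)} = topspace (mtopology_of M)"
            by (auto simp: indicator_def)
          then show ?thesis by (metis openin_topspace)
        next
          case 2
          then have "{x \<in> mspace M. a < (indicator G x :: real)} = G"
            using G_sub by (auto simp: indicator_def split: if_splits)
          then show ?thesis using G(1) by simp
        next
          case 3
          then have "{x \<in> mspace M. a < (indicator G x :: real)} = {}"
            using order.trans[OF 3, of "indicator G _"] by (auto simp: not_less intro: order_trans[OF indicator_le_1])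
          then show ?thesis by (simp only: openin_empty)
        qed
      qed
      from envelope_tendsto[where p = "\<lambda>_ x. x" and \<epsilon> = "\<lambda>_. 0", OF _ _ _ _ this True]
      show ?thesis using True by (simp add: bump_def)
    next
      case False
      then have "x \<notin> G" using G_sub by auto
      then show ?thesis using False by (simp add: bump_def)
    qed
    have conv: "(\<lambda>k. \<integral>x. ?\<phi> k x \<partial>\<kappa>) \<longlonglongrightarrow> measure \<kappa> G" if \<kappa>: "finite_away M C \<kappa>" for \<kappa>
    proof -
      have int: "integrable \<kappa> (indicator G :: _ \<Rightarrow> real)"
        using G_sets finite_away_sets[OF \<kappa>] fin[OF \<kappa> G(2)] by (simp add: integrable_indicator_iff less_top)
      have "(\<lambda>k. \<integral>x. ?\<phi> k x \<partial>\<kappa>) \<longlonglongrightarrow> (\<integral>x. indicator G x \<partial>\<kappa>)"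
        using test_function_integrable[OF C \<phi>_test \<kappa>] int lim
        by (intro integral_dominated_convergence[where w = "indicator G"])
          (auto simp: abs_of_nonneg[OF bump_nonneg] bump_le_indicator)
      moreover have "(\<integral>x. indicator G x \<partial>\<kappa>) = measure \<kappa> G"
        using G_sub sets_eq_imp_space_eq[OF finite_away_sets[OF \<kappa>]] by (simp add: Int_absorb2)
      ultimately show ?thesis by simp
    qed
    have "measure \<mu> G = measure \<nu> G"
      using LIMSEQ_unique[OF conv[OF \<mu>]] conv[OF \<nu>] eq[OF \<phi>_test] by simp
    then show ?thesis
      using fin[OF \<mu> G(2)] fin[OF \<nu> G(2)] by (simp add: emeasure_eq_ennreal_measure)
  qed
  have "density \<mu> (indicator W) = density \<nu> (indicator W)"
  proof (rule measure_eqI_generator_eq[where E = "{A. openin (mtopology_of M) A}" and \<Omega> = "mspace M"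
        and A = "\<lambda>_. mspace M"])
    show "Int_stable {A. openin (mtopology_of M) A}"
      by (auto simp: Int_stable_def)
    show "{A. openin (mtopology_of M) A} \<subseteq> Pow (mspace M)"
      using openin_subset[of "mtopology_of M"] by auto
    show "emeasure (density \<mu> (indicator W)) X = emeasure (density \<nu> (indicator W)) X"
      if "X \<in> {A. openin (mtopology_of M) A}" for X
      using that W_sets finite_away_sets[OF \<mu>] finite_away_sets[OF \<nu>] open_eq[of "W \<inter> X"] W(1)
      by (simp add: emeasure_restricted openin_sets_borel_metric openin_Int)
    show "sets (density \<mu> (indicator W)) = sigma_sets (mspace M) {A. openin (mtopology_of M) A}"
      "sets (density \<nu> (indicator W)) = sigma_sets (mspace M) {A. openin (mtopology_of M) A}"
      using finite_away_sets[OF \<mu>] finite_away_sets[OF \<nu>] by (simp_all add: sets_borel_metric)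
    show "range (\<lambda>_. mspace M) \<subseteq> {A. openin (mtopology_of M) A}"
      using openin_topspace[of "mtopology_of M"] by auto
    have "mspace M \<in> sets (borel_metric M)"
      by (metis space_borel_metric sets.top)
    then show "emeasure (density \<mu> (indicator W)) (mspace M) \<noteq> \<infinity>"
      using W_sets finite_away_sets[OF \<mu>] fin[OF \<mu>, of "W \<inter> mspace M"] by (simp add: emeasure_restricted)
  qed auto
  then have "emeasure (density \<mu> (indicator W)) B = emeasure (density \<nu> (indicator W)) B"
    by simp
  moreover have "W \<inter> B = B" using W(2) r(2) by auto
  ultimately show ?thesis
    using W_sets B finite_away_sets[OF \<mu>] finite_away_sets[OF \<nu>] by (simp add: emeasure_restricted)
qed

section \<open>Limits of rescaled laws\<close>

text \<open>The convergence clause of \<^const>\<open>RV\<close> on its own, so that it can be transported along maps and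
  between measures apart from the conditions on \<open>g\<close> and on the mass of \<open>\<mu>\<close>.\<close>

definition scaled_law_tendsto :: "'a metric \<Rightarrow> (real \<Rightarrow> 'a \<Rightarrow> 'a) \<Rightarrow> 'a set \<Rightarrow> (real \<Rightarrow> real)
    \<Rightarrow> 'a measure \<Rightarrow> 'w measure \<Rightarrow> ('w \<Rightarrow> 'a) \<Rightarrow> bool" where
  "scaled_law_tendsto M T C g \<mu> P \<xi> \<longleftrightarrow>
     (\<forall>f. test_function M (exclusion_ideal M C) f \<longrightarrow>
       ((\<lambda>t. g t * (\<integral>\<omega>. f (T (inverse t) (\<xi> \<omega>)) \<partial>P)) \<longlongrightarrow> (\<integral>x. f x \<partial>\<mu>)) at_top)"

lemma scaled_law_tendstoD:
  "scaled_law_tendsto M T C g \<mu> P \<xi> \<Longrightarrow> test_function M (exclusion_ideal M C) f \<Longrightarrow>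
    ((\<lambda>t. g t * (\<integral>\<omega>. f (T (inverse t) (\<xi> \<omega>)) \<partial>P)) \<longlongrightarrow> (\<integral>x. f x \<partial>\<mu>)) at_top"
  by (simp add: scaled_law_tendsto_def)

text \<open>The integral of a test function depends only on the values of the measure on the ideal.\<close>

lemma scaled_law_tendsto_cong:
  assumes C: "C \<subseteq> mspace M" and sets: "sets \<mu> = sets (borel_metric M)" "sets \<nu> = sets (borel_metric M)"
    and eq: "\<And>B r. B \<in> sets (borel_metric M) \<Longrightarrow> r > 0 \<Longrightarrow> B \<subseteq> far_set M C r \<Longrightarrow>
      emeasure \<mu> B = emeasure \<nu> B"
    and lim: "scaled_law_tendsto M T C g \<mu> P \<xi>"
  shows "scaled_law_tendsto M T C g \<nu> P \<xi>"
  unfolding scaled_law_tendsto_def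
proof (intro allI impI)
  fix f assume f: "test_function M (exclusion_ideal M C) f"
  obtain K r where K: "continuous_map (mtopology_of M) euclideanreal f"
    "K > 0" "\<And>x. \<bar>f x\<bar> \<le> K" "r > 0" "\<And>x. f x \<noteq> 0 \<Longrightarrow> x \<in> far_set M C r"
    using test_functionE[OF C f] by metis
  have "(\<integral>x. f x \<partial>\<mu>) = (\<integral>x. f x \<partial>\<nu>)"
  proof (rule integral_cong_on_support[where A = "far_set M C r"])
    show "f \<in> borel_measurable \<mu>"
      using borel_measurable_continuous_map[OF K(1)] sets(1) measurable_cong_sets by blast
  qed (use K sets far_set_sets[OF C] eq in auto)
  then show "((\<lambda>t. g t * (\<integral>\<omega>. f (T (inverse t) (\<xi> \<omega>)) \<partial>P)) \<longlongrightarrow> (\<integral>x. f x \<partial>\<nu>)) at_top"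
    using scaled_law_tendstoD[OF lim f] by simp
qed

lemma scaled_law_tendsto_unique:
  assumes C: "C \<subseteq> mspace M" and \<mu>: "finite_away M C \<mu>" and \<nu>: "finite_away M C \<nu>"
    and lim: "scaled_law_tendsto M T C g \<mu> P \<xi>" "scaled_law_tendsto M T C g \<nu> P \<xi>"
    and B: "B \<in> sets (borel_metric M)" "r > 0" "B \<subseteq> far_set M C r"
  shows "emeasure \<mu> B = emeasure \<nu> B"
proof (rule test_functions_determine[OF C \<mu> \<nu> _ B])
  fix f assume f: "test_function M (exclusion_ideal M C) f"
  show "(\<integral>x. f x \<partial>\<mu>) = (\<integral>x. f x \<partial>\<nu>)"
    by (rule tendsto_unique[OF _ scaled_law_tendstoD[OF lim(1) f] scaled_law_tendstoD[OF lim(2) f]]) simp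
qed

text \<open>This makes composition with \<open>p\<close> preserve test functions and image measures under \<open>p\<close> finite on the
  ideal, since it says that preimages of ideal sets are ideal sets.\<close>

definition pulls_back_far :: "'a metric \<Rightarrow> 'a set \<Rightarrow> 'b metric \<Rightarrow> 'b set \<Rightarrow> ('a \<Rightarrow> 'b) \<Rightarrow> bool" where
  "pulls_back_far M C N D p \<longleftrightarrow>
     (\<forall>r>0. \<exists>s>0. \<forall>x\<in>mspace M. p x \<in> far_set N D r \<longrightarrow> x \<in> far_set M C s)"

lemma test_function_comp:
  assumes C: "C \<subseteq> mspace M" and D: "D \<subseteq> mspace N"
    and p: "continuous_map (mtopology_of M) (mtopology_of N) p" and far: "pulls_back_far M C N D p"
    and f: "test_function N (exclusion_ideal N D) f"
  shows "test_function M (exclusion_ideal M C) (\<lambda>x. if x \<in> mspace M then f (p x) else 0)"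
proof -
  obtain K r where K: "continuous_map (mtopology_of N) euclideanreal f"
    "K > 0" "\<And>x. \<bar>f x\<bar> \<le> K" "r > 0" "\<And>x. f x \<noteq> 0 \<Longrightarrow> x \<in> far_set N D r"
    using test_functionE[OF D f] by metis
  obtain s where s: "s > 0" "\<And>x. x \<in> mspace M \<Longrightarrow> p x \<in> far_set N D r \<Longrightarrow> x \<in> far_set M C s"
    using far K(4) unfolding pulls_back_far_def by metis
  show ?thesis
  proof (rule test_functionI[OF C _ _ s(1), where K = K])
    show "continuous_map (mtopology_of M) euclideanreal (\<lambda>x. if x \<in> mspace M then f (p x) else 0)"
      by (rule continuous_map_eq[OF continuous_map_compose[OF p K(1)]]) simp
  qed (use K s in \<open>auto split: if_splits\<close>)
qed

lemma finite_away_distr: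
  assumes C: "C \<subseteq> mspace M" and D: "D \<subseteq> mspace N"
    and p: "continuous_map (mtopology_of M) (mtopology_of N) p" and far: "pulls_back_far M C N D p"
    and \<mu>: "finite_away M C \<mu>"
  shows "finite_away N D (distr \<mu> (borel_metric N) p)"
  unfolding finite_away_def
proof (intro conjI allI impI)
  fix r :: real assume "r > 0"
  then obtain s where s: "s > 0" "\<And>x. x \<in> mspace M \<Longrightarrow> p x \<in> far_set N D r \<Longrightarrow> x \<in> far_set M C s"
    using far unfolding pulls_back_far_def by metis
  have p': "p \<in> \<mu> \<rightarrow>\<^sub>M borel_metric N"
    using measurable_borel_metric_continuous_map[OF p] finite_away_sets[OF \<mu>] measurable_cong_sets by blast
  have "emeasure (distr \<mu> (borel_metric N) p) (far_set N D r) = emeasure \<mu> (p -` far_set N D r \<inter> space \<mu>)"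
    by (rule emeasure_distr[OF p' far_set_sets[OF D]])
  also have "\<dots> \<le> emeasure \<mu> (far_set M C s)"
    using s far_set_sets[OF C] finite_away_sets[OF \<mu>] sets_eq_imp_space_eq[OF finite_away_sets[OF \<mu>]]
    by (intro emeasure_mono) auto
  finally show "emeasure (distr \<mu> (borel_metric N) p) (far_set N D r) < \<infinity>"
    using finite_away_finite[OF \<mu> s(1)] by (rule le_less_trans)
qed simp

lemma scaled_law_tendsto_distr:
  assumes C: "C \<subseteq> mspace M" and D: "D \<subseteq> mspace N"
    and p: "continuous_map (mtopology_of M) (mtopology_of N) p" and far: "pulls_back_far M C N D p"
    and sets: "sets \<mu> = sets (borel_metric M)"
    and scale: "\<And>s \<omega>. T s (\<xi> \<omega>) \<in> mspace M" "\<And>s x. p (T s x) = T' s (p x)"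
    and lim: "scaled_law_tendsto M T C g \<mu> P \<xi>"
  shows "scaled_law_tendsto N T' D g (distr \<mu> (borel_metric N) p) P (\<lambda>\<omega>. p (\<xi> \<omega>))"
  unfolding scaled_law_tendsto_def
proof (intro allI impI)
  fix f assume f: "test_function N (exclusion_ideal N D) f"
  let ?h = "\<lambda>x. if x \<in> mspace M then f (p x) else 0"
  have p': "p \<in> \<mu> \<rightarrow>\<^sub>M borel_metric N"
    using measurable_borel_metric_continuous_map[OF p] sets measurable_cong_sets by blast
  have f': "f \<in> borel_measurable (borel_metric N)"
    using test_functionE[OF D f] borel_measurable_continuous_map by metis
  have "(\<integral>x. f x \<partial>distr \<mu> (borel_metric N) p) = (\<integral>x. f (p x) \<partial>\<mu>)"
    by (rule integral_distr[OF p' f'])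
  also have "\<dots> = (\<integral>x. ?h x \<partial>\<mu>)"
    using sets_eq_imp_space_eq[OF sets] by (intro Bochner_Integration.integral_cong) auto
  finally show "((\<lambda>t. g t * (\<integral>\<omega>. f (T' (inverse t) (p (\<xi> \<omega>))) \<partial>P)) \<longlongrightarrow>
      (\<integral>x. f x \<partial>distr \<mu> (borel_metric N) p)) at_top"
    using scaled_law_tendstoD[OF lim test_function_comp[OF C D p far f]] scale by simp
qed

section \<open>Sequences and their projections\<close>

declare mspace_Rm_metric [simp del]

text \<open>Both metrics in use induce the topology of pointwise convergence. The coordinates being continuous
  for the metric gives one inclusion, the metric being continuous for pointwise convergence the other.
  Continuity and measurability can then be read off from the product topology.\<close>

lemma mtopology_of_eq_top_of_set:
  fixes M :: "(nat \<Rightarrow> real) metric"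
  assumes coord: "\<And>i. continuous_map (mtopology_of M) euclideanreal (\<lambda>x. x i)"
    and dist: "\<And>x. x \<in> mspace M \<Longrightarrow> continuous_on (mspace M) (mdist M x)"
  shows "mtopology_of M = top_of_set (mspace M)"
  unfolding topology_eq
proof (intro allI iffI)
  interpret Metric_space "mspace M" "mdist M" by blast
  fix S
  have "continuous_map (mtopology_of M) euclidean (\<lambda>x. x)"
    unfolding euclidean_product_topology[symmetric] continuous_map_componentwise_UNIV
    using coord by simp
  moreover assume "openin (top_of_set (mspace M)) S"
  then obtain T where "open T" "S = mspace M \<inter> T"
    by (auto simp: openin_open)
  ultimately show "openin (mtopology_of M) S"
    by (auto simp: continuous_map_def Collect_conj_eq)
next
  interpret Metric_space "mspace M" "mdist M" by blast
  fix S assume "openin (mtopology_of M) S"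
  then have S: "S \<subseteq> mspace M" "\<And>x. x \<in> S \<Longrightarrow> \<exists>r>0. mball x r \<subseteq> S"
    by (auto simp: mtopology_of_def openin_mtopology)
  show "openin (top_of_set (mspace M)) S"
  proof (subst openin_subopen, intro ballI)
    fix x assume x: "x \<in> S"
    then obtain r where r: "r > 0" "mball x r \<subseteq> S" using S(2) by blast
    have "openin (top_of_set (mspace M)) (mspace M \<inter> mdist M x -` {..<r})"
      using x S(1) by (intro continuous_openin_preimage_gen dist) auto
    moreover have "mspace M \<inter> mdist M x -` {..<r} = mball x r"
      using x S(1) by auto
    ultimately show "\<exists>T. openin (top_of_set (mspace M)) T \<and> x \<in> T \<and> T \<subseteq> S"
      using r x S(1) by (intro exI[of _ "mball x r"]) auto
  qed
qed

lemma summable_half_powers: "summable (\<lambda>i. (1/2) ^ Suc i :: real)"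
  by (subst summable_Suc_iff) (simp add: summable_geometric)

lemma seq_dist_mono:
  assumes "\<And>i. \<bar>x i - y i\<bar> \<le> \<bar>x' i - y' i\<bar>"
  shows "seq_dist x y \<le> seq_dist x' y'"
  unfolding seq_dist_def
  by (intro suminf_le summable_seq_dist mult_left_mono min.mono assms) auto

lemma seq_dist_coord: "(1/2) ^ Suc i * min \<bar>x i - y i\<bar> 1 \<le> seq_dist x y"
  using sum_le_suminf[OF summable_seq_dist, of "{i}" x y] by (simp add: seq_dist_def)

lemma continuous_map_seq_coord: "continuous_map (mtopology_of seq_metric) euclideanreal (\<lambda>x. x i)"
  unfolding mtopology_of_euclidean[symmetric] mtopology_of_def
proof (rule iffD2[OF Metric_space.metric_continuous_map[OF Metric_space_mspace_mdist Metric_space_mspace_mdist]])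
  show "(\<lambda>x. x i) ` mspace seq_metric \<subseteq> mspace euclidean_metric \<and>
    (\<forall>a\<in>mspace seq_metric. \<forall>e>0. \<exists>d>0. \<forall>x. x \<in> mspace seq_metric \<and>
       mdist seq_metric a x < d \<longrightarrow> mdist euclidean_metric (a i) (x i) < e)"
  proof (intro conjI ballI allI impI)
    fix a :: "nat \<Rightarrow> real" and e :: real assume e: "0 < e"
    show "\<exists>d>0. \<forall>x. x \<in> mspace seq_metric \<and> mdist seq_metric a x < d \<longrightarrow> mdist euclidean_metric (a i) (x i) < e"
    proof (intro exI[of _ "(1/2) ^ Suc i * min e 1"] conjI allI impI)
      show "0 < (1/2) ^ Suc i * min e (1::real)" using e by simp
      fix x assume "x \<in> mspace seq_metric \<and> mdist seq_metric a x < (1/2) ^ Suc i * min e 1"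
      then have "seq_dist a x < (1/2) ^ Suc i * min e 1"
        by (simp only: mdist_seq_metric)
      then have "(1/2) ^ Suc i * min \<bar>a i - x i\<bar> 1 < (1/2) ^ Suc i * min e (1::real)"
        by (rule le_less_trans[OF seq_dist_coord])
      then have "min \<bar>a i - x i\<bar> 1 < min e 1"
        by (simp only: mult_less_cancel_left_pos zero_less_power zero_less_divide_1_iff zero_less_numeral)
      then show "mdist euclidean_metric (a i) (x i) < e"
        by (simp add: dist_real_def min_def split: if_splits)
    qed
  qed auto
qed

lemma continuous_on_seq_dist: "continuous_on UNIV (seq_dist x)"
proof -
  let ?f = "\<lambda>i y. (1/2) ^ Suc i * min \<bar>x i - y i\<bar> (1::real)"
  have "uniform_limit UNIV (\<lambda>n y. \<Sum>i<n. ?f i y) (\<lambda>y. \<Sum>i. ?f i y) sequentially"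
    by (rule Weierstrass_m_test[OF _ summable_half_powers]) (simp add: abs_mult mult_left_le)
  moreover have "\<forall>\<^sub>F n in sequentially. continuous_on UNIV (\<lambda>y. \<Sum>i<n. ?f i y)"
    by (intro always_eventually allI continuous_intros) auto
  ultimately show ?thesis
    unfolding seq_dist_def by (intro uniform_limit_theorem[where F = sequentially]) auto
qed

lemma mtopology_of_seq_metric: "mtopology_of seq_metric = euclidean"
  using mtopology_of_eq_top_of_set[of seq_metric] continuous_map_seq_coord continuous_on_seq_dist
  by simp

lemma sets_borel_seq_metric: "sets (borel_metric seq_metric) = sets borel"
  by (simp add: sets_borel_metric mtopology_of_seq_metric borel_def)

abbreviation L2_dist :: "nat \<Rightarrow> (nat \<Rightarrow> real) \<Rightarrow> (nat \<Rightarrow> real) \<Rightarrow> real" where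
  "L2_dist m x y \<equiv> L2_set (\<lambda>i. x i - y i) {..<m}"

lemma L2_dist_coord: "i < m \<Longrightarrow> \<bar>x i - y i\<bar> \<le> L2_dist m x y"
  using member_le_L2_set[of "{..<m}" i "\<lambda>i. \<bar>x i - y i\<bar>"] by (simp add: L2_set_def)

lemma L2_dist_mono:
  assumes "m \<le> n"
  shows "L2_dist m x y \<le> L2_dist n x y"
  unfolding L2_set_def using assms by (intro real_sqrt_le_mono sum_mono2) auto

lemma mspace_Rm: "mspace (Rm_metric m) = {x. \<forall>i\<ge>m. x i = 0}"
  by (simp add: mspace_Rm_metric topspace_Euclidean_space)

lemma continuous_map_Rm_coord: "continuous_map (mtopology_of (Rm_metric m)) euclideanreal (\<lambda>x. x i)"
proof -
  have "Lipschitz_continuous_map (Rm_metric m) euclidean_metric (\<lambda>x. x i)"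
    unfolding Lipschitz_continuous_map_def
  proof (intro conjI exI[of _ 1] ballI)
    fix x y assume "x \<in> mspace (Rm_metric m)" "y \<in> mspace (Rm_metric m)"
    then show "mdist euclidean_metric (x i) (y i) \<le> 1 * mdist (Rm_metric m) x y"
      using L2_dist_coord[of i m x y] by (cases "i < m") (auto simp: mspace_Rm dist_real_def)
  qed auto
  from Lipschitz_continuous_imp_continuous_map[OF this] show ?thesis
    by simp
qed

lemma mtopology_of_Rm_metric: "mtopology_of (Rm_metric m) = top_of_set (mspace (Rm_metric m))"
proof (rule mtopology_of_eq_top_of_set[OF continuous_map_Rm_coord])
  show "continuous_on (mspace (Rm_metric m)) (mdist (Rm_metric m) x)" for x
    unfolding mdist_Rm_metric L2_set_def
    by (intro continuous_intros continuous_on_subset[OF continuous_on_product_coordinates]) auto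
qed

lemma seq_proj_mspace: "seq_proj m x \<in> mspace (Rm_metric m)"
  by (simp add: mspace_Rm seq_proj_def)

lemma seq_proj_image_mspace: "seq_proj m ` C \<subseteq> mspace (Rm_metric m)"
  using seq_proj_mspace by blast

lemma seq_proj_id: "x \<in> mspace (Rm_metric m) \<Longrightarrow> seq_proj m x = x"
  by (auto simp: mspace_Rm seq_proj_def)

lemma seq_proj_seq_proj: "seq_proj m (seq_proj n x) = seq_proj (min m n) x"
  by (auto simp: seq_proj_def)

lemma seq_proj_scale: "seq_proj m (seq_scale t x) = seq_scale t (seq_proj m x)"
  by (auto simp: seq_proj_def seq_scale_def)

lemma continuous_on_seq_proj: "continuous_on UNIV (seq_proj m)"
proof (rule continuous_on_coordinatewise_then_product)
  show "continuous_on UNIV (\<lambda>x. seq_proj m x i)" for i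
    by (cases "i < m") (simp_all add: seq_proj_def)
qed

lemma far_set_Rm_iff:
  "x \<in> far_set (Rm_metric m) (seq_proj m ` C) r \<longleftrightarrow>
     x \<in> mspace (Rm_metric m) \<and> (\<forall>c\<in>C. r \<le> L2_dist m x c)"
proof -
  have "L2_dist m x (seq_proj m c) = L2_dist m x c" for c
    unfolding L2_set_def by (intro arg_cong[where f = sqrt] sum.cong) (auto simp: seq_proj_def)
  then show ?thesis by (simp add: far_set_def)
qed

lemma seq_proj_far_iff:
  "seq_proj n x \<in> far_set (Rm_metric n) (seq_proj n ` C) r \<longleftrightarrow> (\<forall>c\<in>C. r \<le> L2_dist n x c)"
proof -
  have "L2_dist n (seq_proj n x) c = L2_dist n x c" for c
    unfolding L2_set_def by (intro arg_cong[where f = sqrt] sum.cong) (auto simp: seq_proj_def)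
  then show ?thesis
    by (simp add: far_set_Rm_iff seq_proj_mspace)
qed

lemma far_seq_iff: "x \<in> far_set seq_metric C r \<longleftrightarrow> (\<forall>c\<in>C. r \<le> seq_dist x c)"
  by (simp add: far_set_def)

text \<open>Some coordinate below \<open>m\<close> carries at least its share of the Euclidean distance, and its weight in the
  sequence distance is at least \<open>2\<^sup>-\<^sup>m\<close>.\<close>

lemma L2_dist_le_imp_seq_dist_ge:
  assumes "r > 0" "r \<le> L2_dist m x y"
  shows "(1/2) ^ m * min (r / real (Suc m)) 1 \<le> seq_dist x y"
proof -
  have "L2_dist m x y \<le> (\<Sum>i<m. \<bar>x i - y i\<bar>)"
    by (rule L2_set_le_sum_abs)
  then have le: "r \<le> (\<Sum>i<m. \<bar>x i - y i\<bar>)" using assms(2) by simp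
  \<comment> \<open>dividing by \<open>m + 1\<close> instead of \<open>m\<close> makes the inequality strict and covers \<open>m = 0\<close>\<close>
  have "\<exists>i<m. r / real (Suc m) \<le> \<bar>x i - y i\<bar>"
  proof (rule ccontr)
    assume "\<not> (\<exists>i<m. r / real (Suc m) \<le> \<bar>x i - y i\<bar>)"
    then have "(\<Sum>i<m. \<bar>x i - y i\<bar>) \<le> (\<Sum>i<m. r / real (Suc m))"
      by (intro sum_mono) force
    also have "\<dots> < r" using assms(1) by (simp add: field_simps)
    finally show False using le by simp
  qed
  then obtain i where i: "i < m" "r / real (Suc m) \<le> \<bar>x i - y i\<bar>" by blast
  have "(1/2) ^ m * min (r / real (Suc m)) 1 \<le> (1/2) ^ Suc i * min \<bar>x i - y i\<bar> (1::real)"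
    using i assms(1) by (intro mult_mono power_decreasing min.mono) auto
  also have "\<dots> \<le> seq_dist x y" by (rule seq_dist_coord)
  finally show ?thesis .
qed

lemma seq_dist_le_proj: "seq_dist x y \<le> seq_dist (seq_proj m x) (seq_proj m y) + (1/2) ^ m"
proof -
  let ?f = "\<lambda>i. (1/2) ^ Suc i * min \<bar>x i - y i\<bar> (1::real)"
  let ?g = "\<lambda>i. (1/2) ^ Suc i * min \<bar>seq_proj m x i - seq_proj m y i\<bar> (1::real)"
  have "seq_dist x y = (\<Sum>i. ?f (i + m)) + (\<Sum>i<m. ?f i)"
    unfolding seq_dist_def by (rule suminf_split_initial_segment[OF summable_seq_dist])
  also have "(\<Sum>i<m. ?f i) = (\<Sum>i<m. ?g i)"
    by (intro sum.cong) (auto simp: seq_proj_def)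
  also have "\<dots> \<le> seq_dist (seq_proj m x) (seq_proj m y)"
    unfolding seq_dist_def by (intro sum_le_suminf summable_seq_dist) auto
  also have "(\<Sum>i. ?f (i + m)) \<le> (\<Sum>i. (1/2) ^ m * (1/2) ^ Suc i)"
  proof (intro suminf_le)
    show "summable (\<lambda>i. ?f (i + m))"
      using summable_seq_dist by (subst summable_iff_shift)
    show "summable (\<lambda>i. (1/2) ^ m * (1/2) ^ Suc i :: real)"
      by (intro summable_mult summable_half_powers)
    show "?f (i + m) \<le> (1/2) ^ m * (1/2) ^ Suc i" for i
      using mult_left_le[of "min \<bar>x (i + m) - y (i + m)\<bar> 1" "(1/2) ^ Suc (i + m)"]
      by (simp add: power_add mult_ac)
  qed
  also have "(\<Sum>i. (1/2) ^ m * (1/2) ^ Suc i) = ((1/2) ^ m :: real)"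
    using suminf_mult[OF summable_half_powers, of "(1/2) ^ m"] power_half_series
    by (simp add: sums_iff)
  finally show ?thesis by simp
qed

text \<open>The coordinates from \<open>m\<close> on contribute at most \<open>2\<^sup>-\<^sup>m \<le> r/2\<close>, so the other half of the distance comes
  from the first \<open>m\<close> coordinates, each of which differs by at most the Euclidean distance.\<close>

lemma seq_dist_ge_imp_L2_dist_ge:
  assumes "(1/2) ^ m \<le> r / 2" "r \<le> seq_dist x y"
  shows "r / 2 \<le> L2_dist m x y"
proof -
  let ?g = "\<lambda>i. (1/2) ^ Suc i * min \<bar>seq_proj m x i - seq_proj m y i\<bar> (1::real)"
  have "seq_dist (seq_proj m x) (seq_proj m y) \<le> (\<Sum>i. (1/2) ^ Suc i * L2_dist m x y)"
    unfolding seq_dist_def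
  proof (intro suminf_le summable_seq_dist summable_mult2 summable_half_powers mult_left_mono)
    show "min \<bar>seq_proj m x i - seq_proj m y i\<bar> 1 \<le> L2_dist m x y" for i
      using L2_dist_coord[of i m x y] by (cases "i < m") (auto simp: seq_proj_def min_le_iff_disj)
  qed simp
  also have "\<dots> = L2_dist m x y"
    using suminf_mult2[OF summable_half_powers, of "L2_dist m x y"] power_half_series
    by (simp add: sums_iff)
  finally show ?thesis
    using seq_dist_le_proj[of x y m] assms by simp
qed

lemma pulls_back_far_seq: "pulls_back_far seq_metric C (Rm_metric m) (seq_proj m ` C) (seq_proj m)"
  unfolding pulls_back_far_def
proof (intro allI impI)
  fix r :: real assume r: "r > 0"
  show "\<exists>s>0. \<forall>x\<in>mspace seq_metric. seq_proj m x \<in> far_set (Rm_metric m) (seq_proj m ` C) r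
      \<longrightarrow> x \<in> far_set seq_metric C s"
  proof (intro exI[of _ "(1/2) ^ m * min (r / real (Suc m)) 1"] conjI ballI impI)
    show "0 < (1/2) ^ m * min (r / real (Suc m)) (1::real)" using r by simp
  next
    fix x assume "seq_proj m x \<in> far_set (Rm_metric m) (seq_proj m ` C) r"
    then show "x \<in> far_set seq_metric C ((1/2) ^ m * min (r / real (Suc m)) 1)"
      using L2_dist_le_imp_seq_dist_ge[OF r, of x _ m]
      unfolding far_seq_iff seq_proj_far_iff by blast
  qed
qed

text \<open>Dropping coordinates decreases Euclidean distances, so points far from the smaller projection of \<open>C\<close>
  are at least as far from the larger one.\<close>

lemma pulls_back_far_Rm:
  assumes "n \<le> m"
  shows "pulls_back_far (Rm_metric m) (seq_proj m ` C) (Rm_metric n) (seq_proj n ` C) (seq_proj n)"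
  unfolding pulls_back_far_def
proof (intro allI impI exI conjI ballI)
  fix r :: real and x
  assume "x \<in> mspace (Rm_metric m)" "seq_proj n x \<in> far_set (Rm_metric n) (seq_proj n ` C) r"
  then show "x \<in> far_set (Rm_metric m) (seq_proj m ` C) r"
    using L2_dist_mono[OF assms]
    by (auto simp: seq_proj_far_iff far_set_Rm_iff[of x] intro: order_trans)
qed

lemma far_seq_imp_far_Rm:
  assumes "r > 0"
  shows "\<forall>\<^sub>F m in sequentially. \<forall>x\<in>far_set seq_metric C r.
    seq_proj m x \<in> far_set (Rm_metric m) (seq_proj m ` C) (r/2)"
proof -
  have "(\<lambda>m. (1/2) ^ m :: real) \<longlonglongrightarrow> 0"
    by (rule LIMSEQ_realpow_zero) auto
  then have "\<forall>\<^sub>F m in sequentially. (1/2) ^ m < r / 2"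
    by (rule order_tendstoD) (use assms in simp)
  then show ?thesis
  proof eventually_elim
    case (elim m)
    then show ?case
      using seq_dist_ge_imp_L2_dist_ge[of m r] less_imp_le
      by (simp add: far_seq_iff seq_proj_far_iff)
  qed
qed

lemma continuous_map_seq_proj: "continuous_map (mtopology_of seq_metric) (mtopology_of (Rm_metric m)) (seq_proj m)"
  unfolding mtopology_of_seq_metric mtopology_of_Rm_metric
  using continuous_on_seq_proj seq_proj_mspace[of m]
  by (auto simp: continuous_map_in_subtopology)

lemma continuous_map_Rm_proj:
  "continuous_map (mtopology_of (Rm_metric m)) (mtopology_of (Rm_metric n)) (seq_proj n)"
  unfolding mtopology_of_Rm_metric
  using continuous_on_subset[OF continuous_on_seq_proj] seq_proj_mspace[of n]
  by (auto simp: continuous_map_in_subtopology)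

lemma continuous_map_Rm_inclusion: "continuous_map (mtopology_of (Rm_metric m)) (mtopology_of seq_metric) (\<lambda>x. x)"
  unfolding mtopology_of_Rm_metric mtopology_of_seq_metric by simp

section \<open>Extension of a consistent family of measures\<close>

lemma seq_proj_borel_measurable [measurable]: "seq_proj m \<in> borel_measurable borel"
  using continuous_on_seq_proj by (rule borel_measurable_continuous_onI)

lemma restrict_borel_measurable:
  "(\<lambda>x::nat \<Rightarrow> real. restrict x J) \<in> borel \<rightarrow>\<^sub>M (\<Pi>\<^sub>M i\<in>J. borel)"
proof -
  have "(\<lambda>x::nat \<Rightarrow> real. restrict x J) \<in> (\<Pi>\<^sub>M i\<in>UNIV. borel) \<rightarrow>\<^sub>M (\<Pi>\<^sub>M i\<in>J. borel)"
    by (rule measurable_restrict_subset) simp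
  then show ?thesis
    using measurable_cong_sets[OF sets_PiM_equal_borel refl] by blast
qed

lemma zero_extension_borel_measurable:
  "(\<lambda>(x::nat \<Rightarrow> real) i. if i < m then x i else 0) \<in> borel_measurable (\<Pi>\<^sub>M i\<in>{..<m}. borel)"
proof (rule measurable_coordinatewise_then_product)
  fix i
  show "(\<lambda>x. if i < m then x i else 0) \<in> borel_measurable (\<Pi>\<^sub>M i\<in>{..<m}. (borel :: real measure))"
    by (cases "i < m") auto
qed

text \<open>The extension theorem for Polish factors works with measures on products over finite index sets \<open>J\<close>,
  whose functions are undefined outside \<open>J\<close>, whereas \<open>L m\<close> lives on sequences that vanish from \<open>m\<close> on.
  The marginal \<open>Q J\<close> is read off from any \<open>L m\<close> with \<open>J \<subseteq> {..<m}\<close>, and zero extension leads back.\<close>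

lemma Kolmogorov_seq_prob:
  fixes L :: "nat \<Rightarrow> (nat \<Rightarrow> real) measure"
  assumes prob: "\<And>m. N \<le> m \<Longrightarrow> prob_space (L m)"
    and cons: "\<And>n m. N \<le> n \<Longrightarrow> n \<le> m \<Longrightarrow> distr (L m) borel (seq_proj n) = L n"
  shows "\<exists>\<nu>. sets \<nu> = sets borel \<and> (\<forall>m\<ge>N. distr \<nu> borel (seq_proj m) = L m)"
proof -
  have sets_L [measurable_cong]: "sets (L m) = sets borel" if "N \<le> m" for m
    using cons[OF that order_refl] by (metis sets_distr)
  let ?B = "\<lambda>J::nat set. \<Pi>\<^sub>M i\<in>J. (borel :: real measure)"
  \<comment> \<open>an index large enough for \<open>L (b J)\<close> to see all coordinates in \<open>J\<close>; inserting 0 serves the empty set\<close>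
  define b where "b J = max N (Suc (Max (insert 0 J)))" for J :: "nat set"
  define Q where "Q J = distr (L (b J)) (?B J) (\<lambda>x. restrict x J)" for J
  have b: "N \<le> b J" "J \<subseteq> {..<b J}" if "finite J" for J
    using that by (auto simp: b_def less_max_iff_disj less_Suc_eq_le)
  have meas: "(\<lambda>x. restrict x J) \<in> L m \<rightarrow>\<^sub>M ?B J" if "N \<le> m" for m J
    using restrict_borel_measurable sets_L[OF that] measurable_cong_sets by blast
  have step: "distr (L n) (?B J) (\<lambda>x. restrict x J) = distr (L m) (?B J) (\<lambda>x. restrict x J)"
    if "N \<le> n" "n \<le> m" "J \<subseteq> {..<n}" for n m J
  proof -
    have "distr (L n) (?B J) (\<lambda>x. restrict x J)
        = distr (distr (L m) borel (seq_proj n)) (?B J) (\<lambda>x. restrict x J)"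
      using cons[OF that(1,2)] by simp
    also have "\<dots> = distr (L m) (?B J) ((\<lambda>x. restrict x J) \<circ> seq_proj n)"
      using sets_L[of m] that
      by (intro distr_distr restrict_borel_measurable) (auto simp: measurable_cong_sets[OF sets_L])
    also have "(\<lambda>x. restrict x J) \<circ> seq_proj n = (\<lambda>x. restrict x J)"
      using that(3) by (auto simp: fun_eq_iff seq_proj_def restrict_def)
    finally show ?thesis .
  qed
  have Q_eq: "Q J = distr (L m) (?B J) (\<lambda>x. restrict x J)" if "finite J" "N \<le> m" "J \<subseteq> {..<m}" for J m
    unfolding Q_def using step[of "b J" "max (b J) m" J] step[of m "max (b J) m" J] b[OF that(1)] that
    by simp
  have Q_proj: "Q J = distr (Q H) (?B J) (\<lambda>f. restrict f J)" if "J \<subseteq> H" "finite H" for J H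
  proof -
    have "distr (Q H) (?B J) (\<lambda>f. restrict f J)
        = distr (L (b H)) (?B J) ((\<lambda>f. restrict f J) \<circ> (\<lambda>x. restrict x H))"
      unfolding Q_def using that b[of H]
      by (intro distr_distr meas measurable_restrict_subset) auto
    also have "(\<lambda>f. restrict f J) \<circ> (\<lambda>x. restrict x H) = (\<lambda>x. restrict x J)"
      using that(1) by (auto simp: fun_eq_iff restrict_def)
    also have "distr (L (b H)) (?B J) (\<lambda>x. restrict x J) = Q J"
      using that b[of H] by (intro Q_eq[symmetric]) (auto intro: finite_subset)
    finally show ?thesis by (rule sym)
  qed
  have Q_prob: "prob_space (Q J)" if "finite J" for J
    unfolding Q_def using b[OF that] prob by (intro prob_space.prob_space_distr meas) auto
  interpret polish_projective UNIV Q
    by (intro polish_projective.intro projective_family.intro Q_proj Q_prob)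
  have "distr lim borel (seq_proj m) = L m" if m: "N \<le> m" for m
  proof (rule measure_eqI)
    show "sets (distr lim borel (seq_proj m)) = sets (L m)"
      using sets_L[OF m] by simp
    have sets_lim: "sets lim = sets (borel :: (nat \<Rightarrow> real) measure)"
      by (simp add: sets_PiM_equal_borel)
    have sp: "seq_proj m \<in> borel_measurable lim" "seq_proj m \<in> borel_measurable (L m)"
      using seq_proj_borel_measurable sets_lim sets_L[OF m] measurable_cong_sets by blast+
    fix A assume "A \<in> sets (distr lim borel (seq_proj m))"
    then have A: "A \<in> sets borel" by simp
    let ?e = "\<lambda>(x::nat \<Rightarrow> real) i. if i < m then x i else 0"
    let ?X = "?e -` A \<inter> space (?B {..<m})"
    have X: "?X \<in> sets (?B {..<m})"
      using zero_extension_borel_measurable A by (rule measurable_sets)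
    have e: "?e (restrict x {..<m}) = seq_proj m x" for x
      by (auto simp: seq_proj_def)
    have emb: "(\<lambda>x. restrict x {..<m}) -` ?X = seq_proj m -` A"
      by (auto simp: e space_PiM)
    have "emeasure (distr lim borel (seq_proj m)) A = emeasure lim (seq_proj m -` A)"
      using sp A by (simp add: emeasure_distr space_PiM)
    also have "seq_proj m -` A = emb UNIV {..<m} ?X"
      using emb by (simp add: prod_emb_def)
    also have "emeasure lim \<dots> = emeasure (Q {..<m}) ?X"
      by (rule emeasure_lim_emb[OF _ _ X]) auto
    also have "\<dots> = emeasure (L m) ((\<lambda>x. restrict x {..<m}) -` ?X \<inter> space (L m))"
      using Q_eq[of "{..<m}" m] m X by (simp add: emeasure_distr[OF meas])
    also have "\<dots> = emeasure (L m) (seq_proj m -` A)"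
      unfolding emb using sets_eq_imp_space_eq[OF sets_L[OF m]] by simp
    also have "\<dots> = emeasure (distr (L m) borel (seq_proj m)) A"
      using sp A sets_eq_imp_space_eq[OF sets_L[OF m]] by (simp add: emeasure_distr)
    finally show "emeasure (distr lim borel (seq_proj m)) A = emeasure (L m) A"
      using cons[OF m order_refl] by simp
  qed
  then show ?thesis
    by (intro exI[of _ lim]) (simp add: sets_PiM_equal_borel)
qed

lemma distr_scale_measure:
  assumes "f \<in> M \<rightarrow>\<^sub>M N"
  shows "distr (scale_measure c M) N f = scale_measure c (distr M N f)"
proof (rule measure_eqI)
  have "f \<in> scale_measure c M \<rightarrow>\<^sub>M N"
    using assms measurable_cong_sets[OF sets_scale_measure refl] by blast
  then show "emeasure (distr (scale_measure c M) N f) A = emeasure (scale_measure c (distr M N f)) A"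
    if "A \<in> sets (distr (scale_measure c M) N f)" for A
    using that assms by (simp add: emeasure_distr space_scale_measure)
qed simp

text \<open>Consistency forces all \<open>L m\<close> to have the same mass, so the probability case applies after
  normalisation unless this mass is zero.\<close>

lemma Kolmogorov_seq:
  fixes L :: "nat \<Rightarrow> (nat \<Rightarrow> real) measure"
  assumes fin: "emeasure (L N) UNIV < \<infinity>"
    and cons: "\<And>n m. N \<le> n \<Longrightarrow> n \<le> m \<Longrightarrow> distr (L m) borel (seq_proj n) = L n"
  shows "\<exists>\<nu>. sets \<nu> = sets borel \<and> (\<forall>m\<ge>N. distr \<nu> borel (seq_proj m) = L m)"
proof -
  have sets_L: "sets (L m) = sets borel" if "N \<le> m" for m
    using cons[OF that order_refl] by (metis sets_distr)
  have sp: "seq_proj n \<in> borel_measurable (L m)" if "N \<le> m" for m n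
    using seq_proj_borel_measurable sets_L[OF that] measurable_cong_sets by blast
  have space_L: "space (L m) = UNIV" if "N \<le> m" for m
    using sets_eq_imp_space_eq[OF sets_L[OF that]] by simp
  define c where "c = emeasure (L N) UNIV"
  have mass: "emeasure (L m) UNIV = c" if "N \<le> m" for m
  proof -
    have "emeasure (distr (L m) borel (seq_proj N)) UNIV = emeasure (L m) UNIV"
      using sp[OF that] space_L[OF that] by (simp add: emeasure_distr)
    then show ?thesis using cons[OF order_refl that] by (simp add: c_def)
  qed
  show ?thesis
  proof (cases "c = 0")
    case True
    have "distr (null_measure borel) borel (seq_proj m) = L m" if "N \<le> m" for m
    proof (rule measure_eqI)
      fix A
      have "emeasure (L m) A \<le> emeasure (L m) UNIV"
        using sets_L[OF that] by (intro emeasure_mono) auto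
      then have "emeasure (L m) A = 0" using mass[OF that] True by simp
      moreover assume "A \<in> sets (distr (null_measure borel) borel (seq_proj m))"
      ultimately show "emeasure (distr (null_measure borel) borel (seq_proj m)) A = emeasure (L m) A"
        using measurable_cong_sets[OF sets_null_measure refl] seq_proj_borel_measurable
        by (subst emeasure_distr) auto
    qed (simp add: sets_L[OF that])
    then show ?thesis by (intro exI[of _ "null_measure borel"]) simp
  next
    case False
    have c: "c < \<infinity>" using fin by (simp add: c_def)
    let ?L = "\<lambda>m. scale_measure (1 / c) (L m)"
    have "\<exists>\<nu>. sets \<nu> = sets borel \<and> (\<forall>m\<ge>N. distr \<nu> borel (seq_proj m) = ?L m)"
    proof (rule Kolmogorov_seq_prob)
      fix m assume m: "N \<le> m"
      show "prob_space (?L m)"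
        using mass[OF m] space_L[OF m] c False
        by (intro prob_spaceI) (simp add: space_scale_measure ennreal_divide_times ennreal_divide_self less_top)
    next
      fix n m assume "N \<le> n" "n \<le> m"
      then show "distr (?L m) borel (seq_proj n) = ?L n"
        using distr_scale_measure[OF sp[of m n]] cons by simp
    qed
    then obtain \<nu> where \<nu>: "sets \<nu> = sets borel" "\<And>m. N \<le> m \<Longrightarrow> distr \<nu> borel (seq_proj m) = ?L m"
      by blast
    have "distr (scale_measure c \<nu>) borel (seq_proj m) = L m" if m: "N \<le> m" for m
    proof -
      have "seq_proj m \<in> borel_measurable \<nu>"
        using seq_proj_borel_measurable \<nu>(1) measurable_cong_sets by blast
      from distr_scale_measure[OF this]
      have "distr (scale_measure c \<nu>) borel (seq_proj m) = scale_measure c (?L m)"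
        using \<nu>(2)[OF m] by simp
      also have "\<dots> = scale_measure (c * (1 / c)) (L m)"
        by simp
      also have "c * (1 / c) = 1"
        using c False by (simp add: ennreal_times_divide ennreal_divide_self less_top)
      finally show ?thesis by simp
    qed
    then show ?thesis
      using \<nu>(1) by (intro exI[of _ "scale_measure c \<nu>"]) simp
  qed
qed

lemma suminf_measure:
  assumes sets: "\<And>j::nat. sets (\<nu> j) = sets M"
  obtains \<mu> where "sets \<mu> = sets M" "\<And>A. A \<in> sets M \<Longrightarrow> emeasure \<mu> A = (\<Sum>j. emeasure (\<nu> j) A)"
proof
  let ?f = "\<lambda>A. \<Sum>j. emeasure (\<nu> j) A"
  let ?\<mu> = "measure_of (space M) (sets M) ?f"
  show sets_\<mu>: "sets ?\<mu> = sets M"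
    by simp
  fix A assume A: "A \<in> sets M"
  show "emeasure ?\<mu> A = ?f A"
  proof (rule emeasure_measure_of[OF refl sets.space_closed])
    show "positive (sets ?\<mu>) ?f"
      by (simp add: positive_def)
    show "countably_additive (sets ?\<mu>) ?f"
    proof (rule countably_additiveI)
      fix F :: "nat \<Rightarrow> _" assume F: "range F \<subseteq> sets ?\<mu>" "disjoint_family F"
      have "(\<Sum>i. ?f (F i)) = (\<Sum>i. \<integral>\<^sup>+j. emeasure (\<nu> j) (F i) \<partial>count_space UNIV)"
        by (simp add: nn_integral_count_space_nat)
      also have "\<dots> = (\<integral>\<^sup>+j. (\<Sum>i. emeasure (\<nu> j) (F i)) \<partial>count_space UNIV)"
        by (rule nn_integral_suminf[symmetric]) simp
      also have "\<dots> = (\<integral>\<^sup>+j. emeasure (\<nu> j) (\<Union>i. F i) \<partial>count_space UNIV)"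
        using F sets by (intro nn_integral_cong suminf_emeasure) auto
      finally show "(\<Sum>i. ?f (F i)) = ?f (\<Union>i. F i)"
        by (simp add: nn_integral_count_space_nat)
    qed
    show "A \<in> sets ?\<mu>" using A by simp
  qed
qed

lemma finite_away_Rm_measurable:
  assumes \<mu>: "finite_away (Rm_metric m) D \<mu>"
  shows "space \<mu> = mspace (Rm_metric m)"
    "(\<lambda>x. x) \<in> borel_measurable \<mu>"
    "seq_proj n \<in> \<mu> \<rightarrow>\<^sub>M borel_metric (Rm_metric n)"
proof -
  note sets = finite_away_sets[OF \<mu>]
  show "space \<mu> = mspace (Rm_metric m)"
    using sets_eq_imp_space_eq[OF sets] by simp
  have "(\<lambda>x. x) \<in> \<mu> \<rightarrow>\<^sub>M borel_metric seq_metric"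
    using measurable_borel_metric_continuous_map[OF continuous_map_Rm_inclusion] sets
      measurable_cong_sets by blast
  then show "(\<lambda>x. x) \<in> borel_measurable \<mu>"
    using measurable_cong_sets[OF refl sets_borel_seq_metric] by blast
  show "seq_proj n \<in> \<mu> \<rightarrow>\<^sub>M borel_metric (Rm_metric n)"
    using measurable_borel_metric_continuous_map[OF continuous_map_Rm_proj] sets
      measurable_cong_sets by blast
qed

lemma seq_proj_measurable_Rm: "seq_proj m \<in> borel \<rightarrow>\<^sub>M borel_metric (Rm_metric m)"
  using measurable_borel_metric_continuous_map[OF continuous_map_seq_proj]
    measurable_cong_sets[OF sets_borel_seq_metric refl] by blast

lemma borel_Int_Rm_sets:
  assumes "A \<in> sets borel"
  shows "A \<inter> mspace (Rm_metric m) \<in> sets (borel_metric (Rm_metric m))"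
proof -
  have "(\<lambda>x. x) \<in> borel_metric (Rm_metric m) \<rightarrow>\<^sub>M borel_metric seq_metric"
    by (rule measurable_borel_metric_continuous_map[OF continuous_map_Rm_inclusion])
  then have "(\<lambda>x. x) -` A \<inter> space (borel_metric (Rm_metric m)) \<in> sets (borel_metric (Rm_metric m))"
    by (rule measurable_sets) (simp add: assms sets_borel_seq_metric)
  then show ?thesis by simp
qed

text \<open>Consistency is required on ideal sets only, as the measures may be infinite elsewhere.\<close>

locale consistent_measures =
  fixes C :: "(nat \<Rightarrow> real) set" and N :: nat and \<mu> :: "nat \<Rightarrow> (nat \<Rightarrow> real) measure"
  assumes finite_away: "\<And>m. N \<le> m \<Longrightarrow> finite_away (Rm_metric m) (seq_proj m ` C) (\<mu> m)"
    and consistent: "\<And>n m B r. N \<le> n \<Longrightarrow> n \<le> m \<Longrightarrow> B \<in> sets (borel_metric (Rm_metric n)) \<Longrightarrow>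
      r > 0 \<Longrightarrow> B \<subseteq> far_set (Rm_metric n) (seq_proj n ` C) r \<Longrightarrow>
      emeasure (\<mu> m) (seq_proj n -` B \<inter> mspace (Rm_metric m)) = emeasure (\<mu> n) B"
begin

text \<open>The radius decreases while the Euclidean distance increases with \<open>n\<close>, so these sets increase. They
  exhaust the ideal.\<close>

definition far_cylinder :: "nat \<Rightarrow> (nat \<Rightarrow> real) set" where
  "far_cylinder n = seq_proj n -` far_set (Rm_metric n) (seq_proj n ` C) (1 / real (Suc n))"

text \<open>The layer \<open>j\<close> is determined by the first \<open>N + j\<close> coordinates, so every \<open>\<mu> m\<close> with \<open>m \<ge> N + j\<close>
  assigns a mass to it, and by consistency all of them assign the same finite one.\<close>

definition layer :: "nat \<Rightarrow> (nat \<Rightarrow> real) set" where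
  "layer = disjointed (\<lambda>j. far_cylinder (N + j))"

text \<open>The measure \<open>\<mu> m\<close> moved along the inclusion of vectors into sequences, which puts all measures on one
  space.\<close>

definition on_sequences :: "nat \<Rightarrow> (nat \<Rightarrow> real) measure" where
  "on_sequences m = distr (\<mu> m) borel (\<lambda>x. x)"

lemma far_cylinder_iff: "x \<in> far_cylinder n \<longleftrightarrow> (\<forall>c\<in>C. 1 / real (Suc n) \<le> L2_dist n x c)"
  unfolding far_cylinder_def vimage_def mem_Collect_eq by (rule seq_proj_far_iff)

lemma far_cylinder_seq_proj:
  assumes "n \<le> m"
  shows "seq_proj m x \<in> far_cylinder n \<longleftrightarrow> x \<in> far_cylinder n"
  unfolding far_cylinder_def vimage_def mem_Collect_eq
  using assms by (simp add: seq_proj_seq_proj min_absorb1)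

lemma far_cylinder_mono:
  assumes "n \<le> m"
  shows "far_cylinder n \<subseteq> far_cylinder m"
proof
  fix x assume x: "x \<in> far_cylinder n"
  have "1 / real (Suc m) \<le> 1 / real (Suc n)"
    using assms by (simp add: frac_le)
  then show "x \<in> far_cylinder m"
    using x L2_dist_mono[OF assms, of x] unfolding far_cylinder_iff by (intro ballI) (blast intro: order_trans)
qed

lemma far_cylinder_sets [measurable]: "far_cylinder n \<in> sets borel"
  unfolding far_cylinder_def
  using measurable_sets[OF seq_proj_measurable_Rm far_set_sets[OF seq_proj_image_mspace]] by simp

lemma layer_subset: "layer j \<subseteq> far_cylinder (N + j)"
  unfolding layer_def by (rule disjointed_subset)

lemma layer_sets [measurable]: "layer j \<in> sets borel"
  unfolding layer_def disjointed_def by measurable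

lemma layer_seq_proj:
  assumes "N + j \<le> m"
  shows "seq_proj m x \<in> layer j \<longleftrightarrow> x \<in> layer j"
  using assms by (auto simp: layer_def disjointed_def far_cylinder_seq_proj)

text \<open>Far cylinders of level \<open>k\<close> meet only the layers up to \<open>k - N\<close>. The infinite sum over the layers is
  therefore a finite one on every ideal set.\<close>

lemma layer_disjoint_far_cylinder:
  assumes "k < N + j" "N \<le> k"
  shows "layer j \<inter> far_cylinder k = {}"
proof -
  have "k - N \<in> {0..<j}" "N + (k - N) = k" using assms by auto
  then show ?thesis
    unfolding layer_def disjointed_def by force
qed

lemma emeasure_on_sequences:
  assumes "N \<le> m" "A \<in> sets borel"
  shows "emeasure (on_sequences m) A = emeasure (\<mu> m) (A \<inter> mspace (Rm_metric m))"
  unfolding on_sequences_def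
  using finite_away_Rm_measurable[OF finite_away[OF assms(1)]] assms(2)
  by (simp add: emeasure_distr)

lemma emeasure_on_sequences_cylinder:
  assumes "N \<le> n" "n \<le> m" "A \<in> sets borel" "r > 0"
    and "\<And>x. x \<in> A \<Longrightarrow> seq_proj n x \<in> far_set (Rm_metric n) (seq_proj n ` C) r"
  shows "emeasure (on_sequences m) (seq_proj n -` A) = emeasure (on_sequences n) A"
proof -
  let ?B = "A \<inter> mspace (Rm_metric n)"
  have B: "?B \<subseteq> far_set (Rm_metric n) (seq_proj n ` C) r"
    using assms(5) seq_proj_id by (metis IntD1 IntD2 subsetI)
  have "seq_proj n -` A \<in> sets borel"
    using measurable_sets[OF seq_proj_borel_measurable assms(3)] by simp
  then have "emeasure (on_sequences m) (seq_proj n -` A) = emeasure (\<mu> m) (seq_proj n -` ?B \<inter> mspace (Rm_metric m))"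
    using assms(1,2) seq_proj_mspace by (subst emeasure_on_sequences) (auto intro!: arg_cong2[where f = emeasure])
  also have "\<dots> = emeasure (\<mu> n) ?B"
    by (rule consistent[OF assms(1,2) borel_Int_Rm_sets[OF assms(3)] assms(4) B])
  also have "\<dots> = emeasure (on_sequences n) A"
    using emeasure_on_sequences[OF assms(1,3)] by simp
  finally show ?thesis .
qed

lemma layer_far: "x \<in> layer j \<Longrightarrow> N + j \<le> n \<Longrightarrow>
    seq_proj n x \<in> far_set (Rm_metric n) (seq_proj n ` C) (1 / real (Suc n))"
  using layer_subset[of j] far_cylinder_mono[of "N + j" n] unfolding far_cylinder_def by blast

lemma layer_measure:
  "\<exists>\<nu>. sets \<nu> = sets borel \<and>
    (\<forall>m\<ge>N + j. distr \<nu> borel (seq_proj m) = density (on_sequences m) (indicator (layer j)))"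
proof (rule Kolmogorov_seq)
  have dens: "emeasure (density (on_sequences m) (indicator (layer j))) A = emeasure (on_sequences m) (layer j \<inter> A)"
    if "A \<in> sets borel" for m A
    using that by (intro emeasure_restricted) (auto simp: on_sequences_def)
  have "emeasure (density (on_sequences (N + j)) (indicator (layer j))) UNIV
      = emeasure (\<mu> (N + j)) (layer j \<inter> mspace (Rm_metric (N + j)))"
    by (subst dens) (auto simp: emeasure_on_sequences)
  also have "\<dots> \<le> emeasure (\<mu> (N + j)) (far_set (Rm_metric (N + j)) (seq_proj (N + j) ` C) (1 / real (Suc (N + j))))"
    using layer_far[of _ j "N + j"] seq_proj_id finite_away_sets[OF finite_away[of "N + j"]]
      far_set_sets[OF seq_proj_image_mspace]
    by (intro emeasure_mono) (fastforce, auto)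
  also have "\<dots> < \<infinity>"
    by (rule finite_away_finite[OF finite_away]) auto
  finally show "emeasure (density (on_sequences (N + j)) (indicator (layer j))) UNIV < \<infinity>" .
  fix n m assume nm: "N + j \<le> n" "n \<le> m"
  show "distr (density (on_sequences m) (indicator (layer j))) borel (seq_proj n)
      = density (on_sequences n) (indicator (layer j))"
  proof (rule measure_eqI)
    fix A assume "A \<in> sets (distr (density (on_sequences m) (indicator (layer j))) borel (seq_proj n))"
    then have A: "A \<in> sets borel" by simp
    have pA: "seq_proj n -` A \<in> sets borel"
      using measurable_sets[OF seq_proj_borel_measurable A] by simp
    have "emeasure (distr (density (on_sequences m) (indicator (layer j))) borel (seq_proj n)) A
        = emeasure (density (on_sequences m) (indicator (layer j))) (seq_proj n -` A)"
    proof (subst emeasure_distr[OF _ A])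
      show "seq_proj n \<in> borel_measurable (density (on_sequences m) (indicator (layer j)))"
        using seq_proj_borel_measurable by (simp add: on_sequences_def)
    qed (simp add: on_sequences_def)
    also have "\<dots> = emeasure (on_sequences m) (layer j \<inter> seq_proj n -` A)"
      by (rule dens[OF pA])
    also have "layer j \<inter> seq_proj n -` A = seq_proj n -` (layer j \<inter> A)"
      using layer_seq_proj[OF nm(1)] by auto
    also have "emeasure (on_sequences m) \<dots> = emeasure (on_sequences n) (layer j \<inter> A)"
      using nm A layer_far[of _ j n]
      by (intro emeasure_on_sequences_cylinder[where r = "1 / real (Suc n)"]) auto
    also have "\<dots> = emeasure (density (on_sequences n) (indicator (layer j))) A"
      by (rule dens[OF A, symmetric])
    finally show "emeasure (distr (density (on_sequences m) (indicator (layer j))) borel (seq_proj n)) A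
        = emeasure (density (on_sequences n) (indicator (layer j))) A" .
  qed (simp add: on_sequences_def)
qed

text \<open>The measure of a cylinder \<open>G\<close> in the ideal is the sum of its parts in the layers. Only finitely many
  layers meet \<open>G\<close>, so one common index \<open>k\<close> evaluates all parts, and additivity of \<open>\<mu> k\<close> puts them
  together again.\<close>

lemma extension:
  obtains \<nu> where "\<nu> \<in> ideal_measures seq_metric (exclusion_ideal seq_metric C)"
    "\<And>m B r. N \<le> m \<Longrightarrow> B \<in> sets (borel_metric (Rm_metric m)) \<Longrightarrow> r > 0 \<Longrightarrow>
      B \<subseteq> far_set (Rm_metric m) (seq_proj m ` C) r \<Longrightarrow> emeasure \<nu> (seq_proj m -` B) = emeasure (\<mu> m) B"
proof -
  obtain \<nu> where \<nu>: "\<And>j. sets (\<nu> j) = sets borel"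
    "\<And>j m. N + j \<le> m \<Longrightarrow> distr (\<nu> j) borel (seq_proj m) = density (on_sequences m) (indicator (layer j))"
  proof -
    have "\<forall>j. \<exists>\<nu>. sets \<nu> = sets borel \<and>
        (\<forall>m\<ge>N + j. distr \<nu> borel (seq_proj m) = density (on_sequences m) (indicator (layer j)))"
      using layer_measure by blast
    from choice[OF this] obtain \<nu> where "\<forall>j. sets (\<nu> j) = sets borel \<and>
        (\<forall>m\<ge>N + j. distr (\<nu> j) borel (seq_proj m) = density (on_sequences m) (indicator (layer j)))" ..
    then show thesis
      by (intro that[of \<nu>]) auto
  qed
  have cyl: "emeasure (\<nu> j) (seq_proj m -` A) = emeasure (on_sequences m) (layer j \<inter> A)"
    if "N + j \<le> m" "A \<in> sets borel" for j m A
  proof -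
    have "seq_proj m \<in> borel_measurable (\<nu> j)"
      using seq_proj_borel_measurable measurable_cong_sets[OF \<nu>(1) refl] by blast
    moreover have "space (\<nu> j) = UNIV"
      using sets_eq_imp_space_eq[OF \<nu>(1)] by simp
    ultimately have "emeasure (\<nu> j) (seq_proj m -` A) = emeasure (distr (\<nu> j) borel (seq_proj m)) A"
      using that(2) by (simp add: emeasure_distr)
    also have "\<dots> = emeasure (on_sequences m) (layer j \<inter> A)"
      unfolding \<nu>(2)[OF that(1)] using that by (intro emeasure_restricted) (auto simp: on_sequences_def)
    finally show ?thesis .
  qed
  obtain \<kappa> where \<kappa>: "sets \<kappa> = sets borel" "\<And>A. A \<in> sets borel \<Longrightarrow> emeasure \<kappa> A = (\<Sum>j. emeasure (\<nu> j) A)"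
    using suminf_measure[of \<nu> borel, OF \<nu>(1)] by blast
  have ext: "emeasure \<kappa> (seq_proj m -` B) = emeasure (\<mu> m) B"
    if m: "N \<le> m" and B: "B \<in> sets (borel_metric (Rm_metric m))" "r > 0"
      "B \<subseteq> far_set (Rm_metric m) (seq_proj m ` C) r" for m B r
  proof -
    obtain k0 where "1 / real (Suc k0) < r"
      using reals_Archimedean[OF B(2)] by (auto simp: inverse_eq_divide)
    define k where "k = max k0 m"
    have "1 / real (Suc k) \<le> 1 / real (Suc k0)"
      by (simp add: k_def frac_le)
    then have k: "m \<le> k" "N \<le> k" "1 / real (Suc k) \<le> r"
      using m \<open>1 / real (Suc k0) < r\<close> by (auto simp: k_def)
    define G where "G = seq_proj m -` B"
    have G_sets: "G \<in> sets borel"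
      unfolding G_def using measurable_sets[OF seq_proj_measurable_Rm B(1)] by simp
    have G_proj: "seq_proj l -` G = G" if "m \<le> l" for l
      using that by (auto simp: G_def seq_proj_seq_proj min_absorb1)
    have G_sub: "G \<subseteq> far_cylinder k"
    proof
      fix x assume "x \<in> G"
      then have "seq_proj m x \<in> far_set (Rm_metric m) (seq_proj m ` C) r"
        using B(3) by (auto simp: G_def)
      then show "x \<in> far_cylinder k"
        unfolding far_cylinder_iff seq_proj_far_iff
        using order_trans[OF k(3) order_trans[OF _ L2_dist_mono[OF k(1)]]] by auto
    qed
    have layer_eq: "emeasure (\<nu> j) G = emeasure (on_sequences k) (layer j \<inter> G)" for j
    proof (cases "N + j \<le> k")
      case True
      then show ?thesis using cyl[OF True G_sets] G_proj[OF k(1)] by simp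
    next
      case False
      then have e: "layer j \<inter> G = {}"
        using layer_disjoint_far_cylinder[of k j] k G_sub by auto
      have "emeasure (\<nu> j) G = emeasure (on_sequences (N + j)) (layer j \<inter> G)"
        using cyl[OF order_refl G_sets, of j] G_proj[of "N + j"] False k by simp
      then show ?thesis using e by simp
    qed
    have "emeasure \<kappa> G = (\<Sum>j. emeasure (on_sequences k) (layer j \<inter> G))"
      using \<kappa>(2)[OF G_sets] layer_eq by simp
    also have "\<dots> = emeasure (on_sequences k) (\<Union>j. layer j \<inter> G)"
    proof (rule suminf_emeasure)
      show "range (\<lambda>j. layer j \<inter> G) \<subseteq> sets (on_sequences k)"
        using G_sets by (auto simp: on_sequences_def)
      show "disjoint_family (\<lambda>j. layer j \<inter> G)"
        using disjoint_family_disjointed[of "\<lambda>j. far_cylinder (N + j)"]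
        unfolding layer_def by (rule disjoint_family_on_bisimulation) auto
    qed
    also have "(\<Union>j. layer j \<inter> G) = G"
    proof -
      have "far_cylinder k \<subseteq> (\<Union>j. far_cylinder (N + j))"
      proof -
        have "N + (k - N) = k" using k(2) by simp
        then show ?thesis by (metis UN_upper UNIV_I)
      qed
      then have "G \<subseteq> (\<Union>j. layer j)"
        using G_sub unfolding layer_def UN_disjointed_eq by blast
      then show ?thesis by blast
    qed
    also have "emeasure (on_sequences k) G = emeasure (\<mu> k) (seq_proj m -` B \<inter> mspace (Rm_metric k))"
      using emeasure_on_sequences[OF k(2) G_sets] by (simp add: G_def)
    also have "\<dots> = emeasure (\<mu> m) B"
      by (rule consistent[OF m k(1) B])
    finally show ?thesis by (simp add: G_def)
  qed
  have "finite_away seq_metric C \<kappa>"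
    unfolding finite_away_def
  proof (intro conjI allI impI)
    show "sets \<kappa> = sets (borel_metric seq_metric)"
      by (simp add: \<kappa>(1) sets_borel_seq_metric)
    fix r :: real assume r: "r > 0"
    have "\<exists>m\<ge>N. \<forall>x\<in>far_set seq_metric C r. seq_proj m x \<in> far_set (Rm_metric m) (seq_proj m ` C) (r/2)"
      using eventually_happens[OF eventually_conj[OF eventually_ge_at_top[of N] far_seq_imp_far_Rm[OF r, of C]]]
      by simp
    then obtain m where m: "N \<le> m" "far_set seq_metric C r \<subseteq> seq_proj m -` far_set (Rm_metric m) (seq_proj m ` C) (r/2)"
      by auto
    have "emeasure \<kappa> (far_set seq_metric C r) \<le> emeasure \<kappa> (seq_proj m -` far_set (Rm_metric m) (seq_proj m ` C) (r/2))"
      using m(2) measurable_sets[OF seq_proj_measurable_Rm far_set_sets[OF seq_proj_image_mspace]] \<kappa>(1)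
      by (intro emeasure_mono) auto
    also have "\<dots> = emeasure (\<mu> m) (far_set (Rm_metric m) (seq_proj m ` C) (r/2))"
      using r by (intro ext[OF m(1) far_set_sets[OF seq_proj_image_mspace], of "r/2"]) auto
    also have "\<dots> < \<infinity>"
      using r by (intro finite_away_finite[OF finite_away[OF m(1)]]) auto
    finally show "emeasure \<kappa> (far_set seq_metric C r) < \<infinity>" .
  qed
  moreover have "emeasure \<kappa> A = 0" if A: "A \<in> sets \<kappa>" and far: "\<forall>r>0. A \<inter> far_set seq_metric C r = {}" for A
  proof -
    have "emeasure (\<nu> j) A = 0" for j
    proof -
      have "layer j \<inter> A = {}"
      proof -
        have pos: "0 < 1 / real (Suc (N + j))" by simp
        obtain s where s: "s > 0" "\<forall>x\<in>mspace seq_metric.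
            seq_proj (N + j) x \<in> far_set (Rm_metric (N + j)) (seq_proj (N + j) ` C) (1 / real (Suc (N + j)))
              \<longrightarrow> x \<in> far_set seq_metric C s"
          using pulls_back_far_seq[of C "N + j", unfolded pulls_back_far_def, THEN spec, THEN mp, OF pos]
          by (elim exE conjE) (rule that)
        have "x \<notin> A" if "x \<in> layer j" for x
        proof -
          have "x \<in> far_set seq_metric C s"
            using s(2) layer_far[OF that order_refl] by simp
          then show ?thesis using far s(1) by blast
        qed
        then show ?thesis by blast
      qed
      then have sub: "A \<subseteq> seq_proj (N + j) -` (- layer j)"
        using layer_seq_proj[of j "N + j"] by auto
      have compl: "- layer j \<in> sets borel"
        using sets.compl_sets[OF layer_sets, of j] by (simp add: Compl_eq_Diff_UNIV)
      have "seq_proj (N + j) -` (- layer j) \<in> sets borel"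
        using measurable_sets[OF seq_proj_borel_measurable compl] by simp
      then have "emeasure (\<nu> j) A \<le> emeasure (\<nu> j) (seq_proj (N + j) -` (- layer j))"
        using sub \<nu>(1) by (intro emeasure_mono) auto
      also have "\<dots> = emeasure (on_sequences (N + j)) (layer j \<inter> - layer j)"
        by (rule cyl[OF order_refl compl])
      finally show ?thesis by simp
    qed
    then show ?thesis
      using A \<kappa> by simp
  qed
  ultimately have "\<kappa> \<in> ideal_measures seq_metric (exclusion_ideal seq_metric C)"
    by (subst ideal_measures_iff) auto
  then show thesis
    by (rule that) (rule ext)
qed

end

section \<open>Convergence on sequences from convergence of all projections\<close>

text \<open>A point outside \<open>far_set M C (r/2)\<close> has distance at least \<open>r/2\<close> from \<open>far_set M C r\<close>, so the penalty
  \<open>k \<ge> 2/r\<close> makes the bump over the larger set equal to 1 on the smaller one.\<close>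

lemma separating_test_function:
  assumes C: "C \<subseteq> mspace M" and r: "r > 0"
  obtains h where "test_function M (exclusion_ideal M C) h" "\<And>x. 0 \<le> h x"
    "\<And>x. x \<in> far_set M C r \<Longrightarrow> h x = 1"
proof -
  let ?S = "far_set M C (r/2)"
  obtain k where k: "2 / r \<le> real k" using real_arch_simple by blast
  have "test_function M (exclusion_ideal M C) (bump M ?S k)"
    using r by (intro bump_test_function[OF C, of "r/2"]) auto
  moreover have "bump M ?S k x = 1" if x: "x \<in> far_set M C r" for x
  proof -
    have xM: "x \<in> mspace M" using x far_set_subset[of M C r] by blast
    have "1 \<le> envelope M (\<lambda>_ x. x) (indicator ?S) k x"
      unfolding envelope_def
    proof (rule cINF_greatest)
      fix y assume y: "y \<in> mspace M"
      show "1 \<le> indicator ?S y + real k * mdist M x y"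
      proof (cases "y \<in> far_set M C (r/2)")
        case False
        then have "r / 2 < mdist M x y"
          using ball_in_far_set[OF x C y, of "r/2"] by fastforce
        then have "real k * (r / 2) \<le> real k * mdist M x y"
          by (intro mult_left_mono) auto
        moreover have "1 \<le> real k * (r / 2)"
          using k r by (simp add: divide_le_eq)
        ultimately show ?thesis by (simp add: add_increasing)
      qed simp
    qed (use xM in auto)
    then show ?thesis
      using bump_le_1[of M ?S k x] xM by (simp add: bump_def)
  qed
  ultimately show thesis
    using bump_nonneg by (intro that)
qed

lemma continuous_on_seq_scale: "continuous_on UNIV (seq_scale s)"
  unfolding seq_scale_def
  by (intro continuous_on_coordinatewise_then_product continuous_intros continuous_on_product_coordinates)

locale projected_limits = prob_space P for P :: "'w measure" +
  fixes C :: "(nat \<Rightarrow> real) set" and \<xi> :: "'w \<Rightarrow> (nat \<Rightarrow> real)" and g :: "real \<Rightarrow> real"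
    and \<mu> :: "(nat \<Rightarrow> real) measure" and N :: nat
  assumes \<xi>: "\<xi> \<in> borel_measurable P"
    and g_nonneg: "\<And>t. t \<ge> 0 \<Longrightarrow> g t \<ge> 0"
    and \<mu>: "finite_away seq_metric C \<mu>"
    and lim: "\<And>m. N \<le> m \<Longrightarrow> scaled_law_tendsto (Rm_metric m) seq_scale (seq_proj m ` C) g
      (distr \<mu> (borel_metric (Rm_metric m)) (seq_proj m)) P (\<lambda>\<omega>. seq_proj m (\<xi> \<omega>))"
begin

definition scaled_mean :: "((nat \<Rightarrow> real) \<Rightarrow> real) \<Rightarrow> real \<Rightarrow> real" where
  "scaled_mean f t = g t * (\<integral>\<omega>. f (seq_scale (inverse t) (\<xi> \<omega>)) \<partial>P)"

lemma sets_\<mu>: "sets \<mu> = sets borel"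
  using finite_away_sets[OF \<mu>] by (simp add: sets_borel_seq_metric)

lemma integrable_scaled:
  fixes f :: "(nat \<Rightarrow> real) \<Rightarrow> real"
  assumes f: "f \<in> borel_measurable borel" and bdd: "\<And>x. \<bar>f x\<bar> \<le> K"
  shows "integrable P (\<lambda>\<omega>. f (seq_scale s (\<xi> \<omega>)))"
proof (rule integrable_const_bound[where B = K])
  have "seq_scale s \<in> borel_measurable borel"
    using continuous_on_seq_scale by (rule borel_measurable_continuous_onI)
  then show "(\<lambda>\<omega>. f (seq_scale s (\<xi> \<omega>))) \<in> borel_measurable P"
    using \<xi> f by (intro measurable_compose[OF _ f] measurable_compose[OF \<xi>])
qed (use bdd in auto)

lemma seq_test_functionE:
  assumes "test_function seq_metric (exclusion_ideal seq_metric C) f"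
  obtains K r where "f \<in> borel_measurable borel"
    "K > 0" "\<And>x. \<bar>f x\<bar> \<le> K" "r > 0" "\<And>x. f x \<noteq> 0 \<Longrightarrow> x \<in> far_set seq_metric C r"
proof -
  obtain K r where *: "continuous_map (mtopology_of seq_metric) euclideanreal f"
    "K > 0" "\<And>x. \<bar>f x\<bar> \<le> K" "r > 0" "\<And>x. f x \<noteq> 0 \<Longrightarrow> x \<in> far_set seq_metric C r"
    using test_functionE[OF _ assms] by (metis mspace_seq_metric subset_UNIV)
  have "f \<in> borel_measurable borel"
    using borel_measurable_continuous_map[OF *(1)] measurable_cong_sets[OF sets_borel_seq_metric refl]
    by blast
  then show thesis
    using *(2-5) by (rule that)
qed

lemma cylinder_limit:
  assumes m: "N \<le> m" and \<phi>: "test_function (Rm_metric m) (exclusion_ideal (Rm_metric m) (seq_proj m ` C)) \<phi>"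
  shows "(scaled_mean (\<lambda>x. \<phi> (seq_proj m x)) \<longlongrightarrow> (\<integral>x. \<phi> (seq_proj m x) \<partial>\<mu>)) at_top"
proof -
  have "\<phi> \<in> borel_measurable (borel_metric (Rm_metric m))"
    using test_functionE[OF seq_proj_image_mspace \<phi>] borel_measurable_continuous_map by metis
  moreover have "seq_proj m \<in> \<mu> \<rightarrow>\<^sub>M borel_metric (Rm_metric m)"
    using seq_proj_measurable_Rm measurable_cong_sets[OF sets_\<mu> refl] by blast
  ultimately have "(\<integral>x. \<phi> x \<partial>distr \<mu> (borel_metric (Rm_metric m)) (seq_proj m)) = (\<integral>x. \<phi> (seq_proj m x) \<partial>\<mu>)"
    by (intro integral_distr)
  then show ?thesis
    using scaled_law_tendstoD[OF lim[OF m] \<phi>] by (simp add: scaled_mean_def[abs_def] seq_proj_scale)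
qed

text \<open>The envelopes of \<open>F\<close> along the projections are test functions of finitely many coordinates below \<open>F\<close>,
  for which the limit is known, and their integrals converge to that of \<open>F\<close>.\<close>

lemma nonneg_lower_bound:
  assumes F: "test_function seq_metric (exclusion_ideal seq_metric C) F" and F0: "\<And>x. 0 \<le> F x"
    and a: "a < (\<integral>x. F x \<partial>\<mu>)"
  shows "\<forall>\<^sub>F t in at_top. a < scaled_mean F t"
proof -
  obtain K r where K: "F \<in> borel_measurable borel"
    "K > 0" "\<And>x. \<bar>F x\<bar> \<le> K" "r > 0" "\<And>x. F x \<noteq> 0 \<Longrightarrow> x \<in> far_set seq_metric C r"
    using seq_test_functionE[OF F] by metis
  have F_cont: "continuous_map (mtopology_of seq_metric) euclideanreal F"
    using test_functionE[OF _ F] by (metis mspace_seq_metric subset_UNIV)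
  define f where "f k = envelope seq_metric seq_proj F k" for k
  have nonexp: "mdist seq_metric (seq_proj k x) (seq_proj k y) \<le> mdist seq_metric x y" for k x y
    by (simp, rule seq_dist_mono) (simp add: seq_proj_def)
  have f0: "0 \<le> f k x" and fF: "f k x \<le> F x" for k x
    unfolding f_def using F0 by (auto intro: envelope_nonneg envelope_le_self)
  have f_proj: "f k (seq_proj k x) = f k x" for k x
    by (simp add: f_def envelope_def seq_proj_seq_proj)
  have f_cont: "continuous_map (mtopology_of seq_metric) euclideanreal (f k)" for k
    unfolding f_def using nonexp F0 by (intro envelope_continuous) auto
  have f_meas: "f k \<in> borel_measurable borel" for k
    using borel_measurable_continuous_map[OF f_cont] measurable_cong_sets[OF sets_borel_seq_metric refl]
    by blast
  have f_lim: "(\<lambda>k. f k x) \<longlonglongrightarrow> F x" for x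
    unfolding f_def
  proof (rule envelope_tendsto)
    show "mdist seq_metric x y \<le> mdist seq_metric (seq_proj k x) (seq_proj k y) + (1/2) ^ k" for k x y
      using seq_dist_le_proj by simp
    show "(\<lambda>k. (1/2) ^ k :: real) \<longlonglongrightarrow> 0"
      by (rule LIMSEQ_realpow_zero) auto
    show "openin (mtopology_of seq_metric) {x \<in> mspace seq_metric. a < F x}" for a
      using openin_continuous_map_preimage[OF F_cont, of "{a<..}"] by simp
  qed (use F0 in auto)
  have int_F: "integrable \<mu> F"
    by (rule test_function_integrable[OF _ F \<mu>]) simp
  have "(\<lambda>k. \<integral>x. f k x \<partial>\<mu>) \<longlonglongrightarrow> (\<integral>x. F x \<partial>\<mu>)"
    using f_lim f0 fF int_F f_meas K(1)
    by (intro integral_dominated_convergence[where w = F]) (auto simp: measurable_cong_sets[OF sets_\<mu> refl])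
  then have "\<forall>\<^sub>F k in sequentially. a < (\<integral>x. f k x \<partial>\<mu>)"
    using a by (rule order_tendstoD)
  then obtain k where k: "a < (\<integral>x. f k x \<partial>\<mu>)" "N \<le> k"
    "\<forall>x\<in>far_set seq_metric C r. seq_proj k x \<in> far_set (Rm_metric k) (seq_proj k ` C) (r/2)"
    using eventually_happens[OF eventually_conj[OF _ eventually_conj[OF eventually_ge_at_top[of N]
      far_seq_imp_far_Rm[OF K(4), of C]]]] by auto
  define \<phi> where "\<phi> x = (if x \<in> mspace (Rm_metric k) then f k x else 0)" for x
  have "test_function (Rm_metric k) (exclusion_ideal (Rm_metric k) (seq_proj k ` C)) \<phi>"
  proof (rule test_functionI[OF seq_proj_image_mspace])
    have "continuous_map (mtopology_of (Rm_metric k)) euclideanreal (f k \<circ> (\<lambda>x. x))"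
      by (rule continuous_map_compose[OF continuous_map_Rm_inclusion f_cont])
    then show "continuous_map (mtopology_of (Rm_metric k)) euclideanreal \<phi>"
      by (rule continuous_map_eq) (simp add: \<phi>_def)
    show "\<bar>\<phi> x\<bar> \<le> K" for x
      using f0[of k x] fF[of k x] K(2) K(3)[of x] by (auto simp: \<phi>_def)
    show "r / 2 > 0" using K(4) by simp
    show "x \<in> far_set (Rm_metric k) (seq_proj k ` C) (r/2)" if "\<phi> x \<noteq> 0" for x
    proof -
      have x: "x \<in> mspace (Rm_metric k)" "f k x \<noteq> 0"
        using that by (auto simp: \<phi>_def split: if_splits)
      then have "F x \<noteq> 0" using f0[of k x] fF[of k x] by auto
      then show ?thesis using k(3) K(5) seq_proj_id[OF x(1)] by metis
    qed
  qed
  from cylinder_limit[OF k(2) this]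
  have "(scaled_mean (f k) \<longlongrightarrow> (\<integral>x. f k x \<partial>\<mu>)) at_top"
    by (simp add: \<phi>_def seq_proj_mspace f_proj)
  then have "\<forall>\<^sub>F t in at_top. a < scaled_mean (f k) t"
    using k(1) by (rule order_tendstoD)
  then show ?thesis
    using eventually_ge_at_top[of 0]
  proof eventually_elim
    case (elim t)
    have "\<bar>f k x\<bar> \<le> K" for x
      using f0[of k x] fF[of k x] K(3)[of x] by auto
    then have "(\<integral>\<omega>. f k (seq_scale (inverse t) (\<xi> \<omega>)) \<partial>P) \<le> (\<integral>\<omega>. F (seq_scale (inverse t) (\<xi> \<omega>)) \<partial>P)"
      using K(3) fF by (intro integral_mono integrable_scaled f_meas K(1))
    then have "scaled_mean (f k) t \<le> scaled_mean F t"
      unfolding scaled_mean_def using g_nonneg[OF elim(2)] by (rule mult_left_mono)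
    then show ?case using elim(1) by simp
  qed
qed

text \<open>Adding a multiple of a cut-off \<open>h\<close> makes \<open>f\<close> nonnegative. As \<open>h\<close> depends on finitely many coordinates,
  its contribution converges and can be subtracted again.\<close>

lemma lower_bound:
  assumes f: "test_function seq_metric (exclusion_ideal seq_metric C) f" and a: "a < (\<integral>x. f x \<partial>\<mu>)"
  shows "\<forall>\<^sub>F t in at_top. a < scaled_mean f t"
proof -
  obtain K r where K: "f \<in> borel_measurable borel"
    "K > 0" "\<And>x. \<bar>f x\<bar> \<le> K" "r > 0" "\<And>x. f x \<noteq> 0 \<Longrightarrow> x \<in> far_set seq_metric C r"
    using seq_test_functionE[OF f] by metis
  obtain n where n: "N \<le> n"
    "\<forall>x\<in>far_set seq_metric C r. seq_proj n x \<in> far_set (Rm_metric n) (seq_proj n ` C) (r/2)"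
    using eventually_happens[OF eventually_conj[OF eventually_ge_at_top[of N]
      far_seq_imp_far_Rm[OF K(4), of C]]] by auto
  obtain \<psi> where \<psi>: "test_function (Rm_metric n) (exclusion_ideal (Rm_metric n) (seq_proj n ` C)) \<psi>"
    "\<And>x. 0 \<le> \<psi> x" "\<And>x. x \<in> far_set (Rm_metric n) (seq_proj n ` C) (r/2) \<Longrightarrow> \<psi> x = 1"
    using separating_test_function[OF seq_proj_image_mspace, of "r/2" n C] K(4) by auto
  define h where "h x = \<psi> (seq_proj n x)" for x
  have h: "test_function seq_metric (exclusion_ideal seq_metric C) h"
    using test_function_comp[OF _ seq_proj_image_mspace continuous_map_seq_proj pulls_back_far_seq \<psi>(1)]
    by (simp add: h_def[abs_def])
  obtain L s where L: "h \<in> borel_measurable borel"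
    "L > 0" "\<And>x. \<bar>h x\<bar> \<le> L" "s > 0" "\<And>x. h x \<noteq> 0 \<Longrightarrow> x \<in> far_set seq_metric C s"
    using seq_test_functionE[OF h] by metis
  have h_lim: "(scaled_mean h \<longlongrightarrow> (\<integral>x. h x \<partial>\<mu>)) at_top"
    using cylinder_limit[OF n(1) \<psi>(1)] by (simp add: h_def[abs_def])
  have h1: "h x = 1" if "f x \<noteq> 0" for x
    using that K(5) n(2) \<psi>(3) by (auto simp: h_def)
  let ?F = "\<lambda>x. K * h x + f x"
  have F: "test_function seq_metric (exclusion_ideal seq_metric C) ?F"
  proof (rule test_functionI)
    have "continuous_map (mtopology_of seq_metric) euclideanreal f"
      "continuous_map (mtopology_of seq_metric) euclideanreal h"
      using test_functionE[OF _ f] test_functionE[OF _ h] by (metis mspace_seq_metric subset_UNIV)+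
    then show "continuous_map (mtopology_of seq_metric) euclideanreal ?F"
      by (intro continuous_map_add continuous_map_real_mult_left)
    show "\<bar>?F x\<bar> \<le> K * L + K" for x
    proof -
      have "\<bar>?F x\<bar> \<le> \<bar>K * h x\<bar> + \<bar>f x\<bar>" by (rule abs_triangle_ineq)
      also have "\<dots> \<le> K * L + K"
        using K(2) K(3)[of x] L(3)[of x] by (intro add_mono) (auto simp: abs_mult)
      finally show ?thesis .
    qed
    show "s > 0" by (rule L(4))
    show "x \<in> far_set seq_metric C s" if "?F x \<noteq> 0" for x
    proof -
      have "h x \<noteq> 0" using that h1[of x] by (cases "f x = 0") auto
      then show ?thesis by (rule L(5))
    qed
  qed simp
  have F0: "0 \<le> ?F x" for x
  proof (cases "f x = 0")
    case True
    then show ?thesis using K(2) \<psi>(2) by (simp add: h_def)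
  next
    case False
    then show ?thesis using h1[OF False] K(3)[of x] by simp
  qed
  have ints: "integrable \<mu> f" "integrable \<mu> h"
    using test_function_integrable[OF _ f \<mu>] test_function_integrable[OF _ h \<mu>] by simp_all
  define \<delta> where "\<delta> = ((\<integral>x. f x \<partial>\<mu>) - a) / 2"
  have \<delta>: "\<delta> > 0" using a by (simp add: \<delta>_def)
  have "(\<integral>x. ?F x \<partial>\<mu>) = K * (\<integral>x. h x \<partial>\<mu>) + (\<integral>x. f x \<partial>\<mu>)"
    using ints by simp
  then have "\<forall>\<^sub>F t in at_top. K * (\<integral>x. h x \<partial>\<mu>) + (\<integral>x. f x \<partial>\<mu>) - \<delta> < scaled_mean ?F t"
    using \<delta> by (intro nonneg_lower_bound[OF F F0]) simp
  moreover have "\<forall>\<^sub>F t in at_top. K * scaled_mean h t < K * (\<integral>x. h x \<partial>\<mu>) + \<delta>"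
    using \<delta> by (intro order_tendstoD(2)[OF tendsto_mult_left[OF h_lim]]) simp
  ultimately show ?thesis
  proof eventually_elim
    case (elim t)
    have "scaled_mean ?F t = K * scaled_mean h t + scaled_mean f t"
      unfolding scaled_mean_def
      using integrable_scaled[OF K(1,3), of "inverse t"] integrable_scaled[OF L(1,3), of "inverse t"]
      by (simp add: algebra_simps)
    then show ?case using elim by (simp add: \<delta>_def field_simps)
  qed
qed

lemma limit_on_sequences: "scaled_law_tendsto seq_metric seq_scale C g \<mu> P \<xi>"
  unfolding scaled_law_tendsto_def
proof (intro allI impI)
  fix f assume f: "test_function seq_metric (exclusion_ideal seq_metric C) f"
  have "(scaled_mean f \<longlongrightarrow> (\<integral>x. f x \<partial>\<mu>)) at_top"
  proof (rule order_tendstoI)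
    show "\<forall>\<^sub>F t in at_top. a < scaled_mean f t" if "a < (\<integral>x. f x \<partial>\<mu>)" for a
      using f that by (rule lower_bound)
    fix a assume a: "(\<integral>x. f x \<partial>\<mu>) < a"
    obtain K r where K: "continuous_map (mtopology_of seq_metric) euclideanreal f"
      "K > 0" "\<And>x. \<bar>f x\<bar> \<le> K" "r > 0" "\<And>x. f x \<noteq> 0 \<Longrightarrow> x \<in> far_set seq_metric C r"
      using test_functionE[OF _ f] by (metis mspace_seq_metric subset_UNIV)
    have "test_function seq_metric (exclusion_ideal seq_metric C) (\<lambda>x. - f x)"
      by (rule test_functionI[where K = K and r = r]) (use K in \<open>auto intro: continuous_map_minus\<close>)
    then have "\<forall>\<^sub>F t in at_top. - a < scaled_mean (\<lambda>x. - f x) t"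
      using a by (intro lower_bound) auto
    then show "\<forall>\<^sub>F t in at_top. scaled_mean f t < a"
      by eventually_elim (simp add: scaled_mean_def)
  qed
  then show "((\<lambda>t. g t * (\<integral>\<omega>. f (seq_scale (inverse t) (\<xi> \<omega>)) \<partial>P)) \<longlongrightarrow> (\<integral>x. f x \<partial>\<mu>)) at_top"
    by (simp add: scaled_mean_def[abs_def])
qed

end

section \<open>Regular variation and its projections\<close>

lemma RV_iff:
  assumes C: "C \<subseteq> mspace M"
  shows "RV M T (exclusion_ideal M C) g \<mu> P \<xi> \<longleftrightarrow>
    g \<in> borel_measurable (restrict_space borel {0..}) \<and> (\<forall>t\<ge>0. g t \<ge> 0) \<and>
    filterlim g at_top at_top \<and> \<mu> \<in> ideal_measures M (exclusion_ideal M C) \<and>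
    (\<exists>r>0. emeasure \<mu> (far_set M C r) > 0) \<and> scaled_law_tendsto M T C g \<mu> P \<xi>"
proof -
  have "(\<exists>B \<in> sets \<mu> \<inter> exclusion_ideal M C. emeasure \<mu> B > 0) \<longleftrightarrow>
      (\<exists>r>0. emeasure \<mu> (far_set M C r) > 0)" if "\<mu> \<in> ideal_measures M (exclusion_ideal M C)"
  proof -
    have sets: "sets \<mu> = sets (borel_metric M)"
      using that by (simp add: ideal_measures_def)
    show ?thesis
    proof
      assume "\<exists>B \<in> sets \<mu> \<inter> exclusion_ideal M C. emeasure \<mu> B > 0"
      then obtain B r where B: "0 < emeasure \<mu> B" "r > 0" "B \<subseteq> far_set M C r"
        by (auto simp: exclusion_ideal_iff)
      have "emeasure \<mu> B \<le> emeasure \<mu> (far_set M C r)"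
        using B(3) far_set_sets[OF C] sets by (intro emeasure_mono) auto
      then show "\<exists>r>0. emeasure \<mu> (far_set M C r) > 0"
        using B(1,2) by (meson less_le_trans)
    next
      assume "\<exists>r>0. emeasure \<mu> (far_set M C r) > 0"
      then obtain r where r: "r > 0" "emeasure \<mu> (far_set M C r) > 0" by blast
      have "far_set M C r \<in> sets \<mu> \<inter> exclusion_ideal M C"
        using r(1) far_set_sets[OF C] sets by (auto simp: exclusion_ideal_iff)
      then show "\<exists>B \<in> sets \<mu> \<inter> exclusion_ideal M C. emeasure \<mu> B > 0"
        using r(2) by blast
    qed
  qed
  then show ?thesis
    unfolding RV_def scaled_law_tendsto_def by blast
qed

text \<open>Restricting to the union of the ideal, a countable union of far sets, removes the mass outside.\<close>

lemma restrict_to_ideal_measure: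
  assumes C: "C \<subseteq> mspace M" and \<mu>: "finite_away M C \<mu>"
  obtains \<nu> where "\<nu> \<in> ideal_measures M (exclusion_ideal M C)"
    "\<And>B r. B \<in> sets (borel_metric M) \<Longrightarrow> r > 0 \<Longrightarrow> B \<subseteq> far_set M C r \<Longrightarrow> emeasure \<nu> B = emeasure \<mu> B"
proof -
  let ?U = "\<Union>n. far_set M C (1 / real (Suc n))"
  let ?\<nu> = "density \<mu> (indicator ?U)"
  have sets: "sets \<mu> = sets (borel_metric M)"
    using \<mu> by (rule finite_away_sets)
  have U: "?U \<in> sets \<mu>"
    using far_set_sets[OF C] sets by auto
  have far_U: "far_set M C r \<subseteq> ?U" if "r > 0" for r
  proof -
    obtain n where "inverse (real (Suc n)) < r"
      using reals_Archimedean[OF \<open>r > 0\<close>] by blast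
    then have "far_set M C r \<subseteq> far_set M C (1 / real (Suc n))"
      by (intro far_set_antimono) (simp add: inverse_eq_divide)
    then show ?thesis by blast
  qed
  have eq: "emeasure ?\<nu> B = emeasure \<mu> B" if "B \<in> sets (borel_metric M)" "r > 0" "B \<subseteq> far_set M C r" for B r
  proof -
    have "?U \<inter> B = B" using far_U[OF that(2)] that(3) by blast
    then show ?thesis
      using emeasure_restricted[OF U, of B] that(1) sets by simp
  qed
  have "?\<nu> \<in> ideal_measures M (exclusion_ideal M C)"
    unfolding ideal_measures_iff[OF C] finite_away_def
  proof (intro conjI ballI allI impI)
    show "sets ?\<nu> = sets (borel_metric M)" using sets by simp
    show "emeasure ?\<nu> (far_set M C r) < \<infinity>" if "r > 0" for r
      using eq[OF far_set_sets[OF C] that order_refl] finite_away_finite[OF \<mu> that] by simp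
    fix B assume "B \<in> sets ?\<nu>" "\<forall>r>0. B \<inter> far_set M C r = {}"
    moreover have "0 < 1 / real (Suc n)" for n by simp
    ultimately have "?U \<inter> B = {}" "B \<in> sets \<mu>" by (blast, simp)
    then show "emeasure ?\<nu> B = 0"
      using emeasure_restricted[OF U, of B] by simp
  qed
  then show thesis
    by (rule that) (rule eq)
qed

lemma ideal_measures_finite_away:
  "C \<subseteq> mspace M \<Longrightarrow> \<mu> \<in> ideal_measures M (exclusion_ideal M C) \<Longrightarrow> finite_away M C \<mu>"
  by (simp add: ideal_measures_iff)

lemma seq_proj_measurable_of_sets:
  "sets \<mu> = sets (borel_metric seq_metric) \<Longrightarrow> seq_proj m \<in> \<mu> \<rightarrow>\<^sub>M borel_metric (Rm_metric m)"
  using measurable_borel_metric_continuous_map[OF continuous_map_seq_proj] measurable_cong_sets by blast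

lemma limit_of_projection:
  assumes "finite_away seq_metric C \<mu>" "scaled_law_tendsto seq_metric seq_scale C g \<mu> P \<xi>"
  shows "finite_away (Rm_metric m) (seq_proj m ` C) (distr \<mu> (borel_metric (Rm_metric m)) (seq_proj m))"
    "scaled_law_tendsto (Rm_metric m) seq_scale (seq_proj m ` C) g
      (distr \<mu> (borel_metric (Rm_metric m)) (seq_proj m)) P (\<lambda>\<omega>. seq_proj m (\<xi> \<omega>))"
proof -
  show "finite_away (Rm_metric m) (seq_proj m ` C) (distr \<mu> (borel_metric (Rm_metric m)) (seq_proj m))"
    by (rule finite_away_distr[OF _ seq_proj_image_mspace continuous_map_seq_proj pulls_back_far_seq assms(1)]) simp
  show "scaled_law_tendsto (Rm_metric m) seq_scale (seq_proj m ` C) g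
      (distr \<mu> (borel_metric (Rm_metric m)) (seq_proj m)) P (\<lambda>\<omega>. seq_proj m (\<xi> \<omega>))"
    by (rule scaled_law_tendsto_distr[OF _ seq_proj_image_mspace continuous_map_seq_proj pulls_back_far_seq
          finite_away_sets[OF assms(1)] _ seq_proj_scale assms(2)]) simp_all
qed

text \<open>The limit measures are the image measures restricted to the union of the ideal. An index \<open>m\<close> is large
  enough once a far set of positive measure projects into a far set, which keeps the limit nonzero.\<close>

lemma RV_seq_imp_RV_Rm:
  assumes RV: "RV seq_metric seq_scale (exclusion_ideal seq_metric C) g \<mu> P \<xi>"
  shows "\<forall>\<^sub>F m in sequentially.
    \<exists>\<mu>\<^sub>m. RV (Rm_metric m) seq_scale (exclusion_ideal (Rm_metric m) (seq_proj m ` C)) g \<mu>\<^sub>m P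
      (\<lambda>\<omega>. seq_proj m (\<xi> \<omega>))"
proof -
  have C: "C \<subseteq> mspace seq_metric" by simp
  note R = RV[unfolded RV_iff[OF C]]
  have fin: "finite_away seq_metric C \<mu>"
    using R ideal_measures_finite_away[OF C] by blast
  have lim: "scaled_law_tendsto seq_metric seq_scale C g \<mu> P \<xi>"
    using R by blast
  obtain r where r: "r > 0" "emeasure \<mu> (far_set seq_metric C r) > 0"
    using R by blast
  show ?thesis
    using far_seq_imp_far_Rm[OF r(1), of C]
  proof eventually_elim
    case (elim m)
    let ?M = "Rm_metric m" let ?C = "seq_proj m ` C"
    let ?\<mu> = "distr \<mu> (borel_metric ?M) (seq_proj m)"
    note D = seq_proj_image_mspace[of m C]
    obtain \<nu> where \<nu>: "\<nu> \<in> ideal_measures ?M (exclusion_ideal ?M ?C)"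
      "\<And>B r. B \<in> sets (borel_metric ?M) \<Longrightarrow> r > 0 \<Longrightarrow> B \<subseteq> far_set ?M ?C r \<Longrightarrow> emeasure \<nu> B = emeasure ?\<mu> B"
      using restrict_to_ideal_measure[OF D limit_of_projection(1)[OF fin lim]] by blast
    have "scaled_law_tendsto ?M seq_scale ?C g \<nu> P (\<lambda>\<omega>. seq_proj m (\<xi> \<omega>))"
    proof (rule scaled_law_tendsto_cong[OF D _ _ _ limit_of_projection(2)[OF fin lim]])
      show "sets \<nu> = sets (borel_metric ?M)"
        using \<nu>(1) by (simp add: ideal_measures_def)
    qed (simp_all add: \<nu>(2))
    moreover have "emeasure \<nu> (far_set ?M ?C (r/2)) > 0"
    proof -
      have "emeasure \<mu> (far_set seq_metric C r) \<le> emeasure \<mu> (seq_proj m -` far_set ?M ?C (r/2) \<inter> space \<mu>)"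
        using elim sets_eq_imp_space_eq[OF finite_away_sets[OF fin]]
          measurable_sets[OF seq_proj_measurable_of_sets[OF finite_away_sets[OF fin]] far_set_sets[OF D]]
        by (intro emeasure_mono) auto
      also have "\<dots> = emeasure ?\<mu> (far_set ?M ?C (r/2))"
        by (rule emeasure_distr[symmetric])
          (rule seq_proj_measurable_of_sets[OF finite_away_sets[OF fin]] far_set_sets[OF D])+
      also have "\<dots> = emeasure \<nu> (far_set ?M ?C (r/2))"
        using r(1) \<nu>(2)[OF far_set_sets[OF D], of "r/2"] by simp
      finally show ?thesis using r(2) by simp
    qed
    moreover have "r / 2 > 0" using r(1) by simp
    ultimately show ?case
      unfolding RV_iff[OF D] using R \<nu>(1) by blast
  qed
qed

text \<open>Consistency holds because \<open>\<mu> n\<close> and the image of \<open>\<mu> m\<close> are both limits for the projection of \<open>\<xi>\<close> to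
  the first \<open>n\<close> coordinates.\<close>

lemma RV_Rm_imp_RV_seq:
  assumes P: "prob_space P" and \<xi>: "\<xi> \<in> measurable P (borel_metric seq_metric)"
    and RV: "\<And>m. N \<le> m \<Longrightarrow>
      RV (Rm_metric m) seq_scale (exclusion_ideal (Rm_metric m) (seq_proj m ` C)) g (\<mu> m) P
        (\<lambda>\<omega>. seq_proj m (\<xi> \<omega>))"
  shows "\<exists>\<nu>. RV seq_metric seq_scale (exclusion_ideal seq_metric C) g \<nu> P \<xi>"
proof -
  have C: "C \<subseteq> mspace seq_metric" by simp
  note D = seq_proj_image_mspace[of _ C]
  note R = RV[unfolded RV_iff[OF D]]
  have fin: "finite_away (Rm_metric m) (seq_proj m ` C) (\<mu> m)" if "N \<le> m" for m
    using R[OF that] ideal_measures_finite_away[OF D] by blast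
  have lim: "scaled_law_tendsto (Rm_metric m) seq_scale (seq_proj m ` C) g (\<mu> m) P (\<lambda>\<omega>. seq_proj m (\<xi> \<omega>))"
    if "N \<le> m" for m
    using R[OF that] by blast
  interpret consistent_measures C N \<mu>
  proof
    show "finite_away (Rm_metric m) (seq_proj m ` C) (\<mu> m)" if "N \<le> m" for m
      using that by (rule fin)
    fix n m :: nat and B and r :: real
    assume nm: "N \<le> n" "n \<le> m" and B: "B \<in> sets (borel_metric (Rm_metric n))" "r > 0"
      "B \<subseteq> far_set (Rm_metric n) (seq_proj n ` C) r"
    have m: "N \<le> m" using nm by simp
    let ?\<mu> = "distr (\<mu> m) (borel_metric (Rm_metric n)) (seq_proj n)"
    have "scaled_law_tendsto (Rm_metric n) seq_scale (seq_proj n ` C) g ?\<mu> P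
        (\<lambda>\<omega>. seq_proj n (seq_proj m (\<xi> \<omega>)))"
    proof (rule scaled_law_tendsto_distr[OF D D continuous_map_Rm_proj pulls_back_far_Rm[OF nm(2)]
          finite_away_sets[OF fin[OF m]] _ seq_proj_scale lim[OF m]])
      show "seq_scale s (seq_proj m (\<xi> \<omega>)) \<in> mspace (Rm_metric m)" for s \<omega>
        by (metis seq_proj_scale seq_proj_mspace)
    qed
    then have "scaled_law_tendsto (Rm_metric n) seq_scale (seq_proj n ` C) g ?\<mu> P (\<lambda>\<omega>. seq_proj n (\<xi> \<omega>))"
      using nm(2) by (simp add: seq_proj_seq_proj min_absorb1)
    then have "emeasure ?\<mu> B = emeasure (\<mu> n) B"
      by (rule scaled_law_tendsto_unique[OF D
            finite_away_distr[OF D D continuous_map_Rm_proj pulls_back_far_Rm[OF nm(2)] fin[OF m]]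
            fin[OF nm(1)] _ lim[OF nm(1)] B])
    then show "emeasure (\<mu> m) (seq_proj n -` B \<inter> mspace (Rm_metric m)) = emeasure (\<mu> n) B"
      using finite_away_Rm_measurable[OF fin[OF m]] B(1) by (simp add: emeasure_distr)
  qed
  obtain \<nu> where \<nu>: "\<nu> \<in> ideal_measures seq_metric (exclusion_ideal seq_metric C)"
    "\<And>m B r. N \<le> m \<Longrightarrow> B \<in> sets (borel_metric (Rm_metric m)) \<Longrightarrow> r > 0 \<Longrightarrow>
      B \<subseteq> far_set (Rm_metric m) (seq_proj m ` C) r \<Longrightarrow> emeasure \<nu> (seq_proj m -` B) = emeasure (\<mu> m) B"
    using extension by blast
  have fin_\<nu>: "finite_away seq_metric C \<nu>"
    using \<nu>(1) by (rule ideal_measures_finite_away[OF C])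
  note sets_\<nu> = finite_away_sets[OF fin_\<nu>]
  have space_\<nu>: "space \<nu> = UNIV"
    using sets_eq_imp_space_eq[OF sets_\<nu>] by simp
  have "projected_limits P C \<xi> g \<nu> N"
  proof (intro projected_limits.intro P projected_limits_axioms.intro)
    show "\<xi> \<in> borel_measurable P"
      using \<xi> measurable_cong_sets[OF refl sets_borel_seq_metric] by blast
    show "0 \<le> g t" if "0 \<le> t" for t
      using R[OF order_refl] that by blast
    show "finite_away seq_metric C \<nu>" by (rule fin_\<nu>)
    fix m assume m: "N \<le> m"
    show "scaled_law_tendsto (Rm_metric m) seq_scale (seq_proj m ` C) g
        (distr \<nu> (borel_metric (Rm_metric m)) (seq_proj m)) P (\<lambda>\<omega>. seq_proj m (\<xi> \<omega>))"
    proof (rule scaled_law_tendsto_cong[OF D finite_away_sets[OF fin[OF m]] _ _ lim[OF m]])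
      show "emeasure (\<mu> m) B = emeasure (distr \<nu> (borel_metric (Rm_metric m)) (seq_proj m)) B"
        if "B \<in> sets (borel_metric (Rm_metric m))" "r > 0" "B \<subseteq> far_set (Rm_metric m) (seq_proj m ` C) r" for B r
        using \<nu>(2)[OF m that] that(1) space_\<nu> seq_proj_measurable_of_sets[OF sets_\<nu>]
        by (simp add: emeasure_distr)
    qed simp
  qed
  then interpret projected_limits P C \<xi> g \<nu> N .
  have "\<exists>s>0. emeasure \<nu> (far_set seq_metric C s) > 0"
  proof -
    obtain r where r: "r > 0" "emeasure (\<mu> N) (far_set (Rm_metric N) (seq_proj N ` C) r) > 0"
      using R[OF order_refl] by blast
    obtain s where s: "s > 0" "\<forall>x\<in>mspace seq_metric.
        seq_proj N x \<in> far_set (Rm_metric N) (seq_proj N ` C) r \<longrightarrow> x \<in> far_set seq_metric C s"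
      using pulls_back_far_seq[of C N, unfolded pulls_back_far_def, THEN spec, THEN mp, OF r(1)]
      by (elim exE conjE) (rule that)
    have "emeasure (\<mu> N) (far_set (Rm_metric N) (seq_proj N ` C) r)
        = emeasure \<nu> (seq_proj N -` far_set (Rm_metric N) (seq_proj N ` C) r)"
      by (rule \<nu>(2)[OF order_refl far_set_sets[OF D] r(1) order_refl, symmetric])
    also have "\<dots> \<le> emeasure \<nu> (far_set seq_metric C s)"
      using s(2) far_set_sets[OF C] sets_\<nu> by (intro emeasure_mono) auto
    finally show ?thesis using r(2) s(1) by (meson less_le_trans)
  qed
  then show ?thesis
    unfolding RV_iff[OF C] using R[OF order_refl] \<nu>(1) limit_on_sequences by blast
qed

lemma RV_in_ideal_measures: "RV M T S g \<mu> P \<xi> \<Longrightarrow> \<mu> \<in> ideal_measures M S"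
  by (simp add: RV_def)

theorem lemma4p3p2:
  fixes C :: "(nat \<Rightarrow> real) set"
    and P :: "'w measure"
    and \<xi> :: "'w \<Rightarrow> (nat \<Rightarrow> real)"
    and g :: "real \<Rightarrow> real"
  assumes "seq_cone C"
    and "\<forall>\<^sub>F m in sequentially. seq_proj m ` C \<subset> mspace (Rm_metric m)"
    and "prob_space P"
    and "\<xi> \<in> measurable P (borel_metric seq_metric)"
  shows
    "((\<exists>\<mu> \<in> ideal_measures seq_metric (exclusion_ideal seq_metric C).
        RV seq_metric seq_scale (exclusion_ideal seq_metric C) g \<mu> P \<xi>)
     \<longleftrightarrow>
     (\<forall>\<^sub>F m in sequentially.
        \<exists>\<mu>\<^sub>m \<in> ideal_measures (Rm_metric m) (exclusion_ideal (Rm_metric m) (seq_proj m ` C)).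
          RV (Rm_metric m) seq_scale (exclusion_ideal (Rm_metric m) (seq_proj m ` C)) g \<mu>\<^sub>m P
            (\<lambda>\<omega>. seq_proj m (\<xi> \<omega>))))
     \<and>
     (\<forall>\<mu> \<mu>' m\<^sub>0.
       RV seq_metric seq_scale (exclusion_ideal seq_metric C) g \<mu> P \<xi> \<and>
       (\<forall>m\<ge>m\<^sub>0. RV (Rm_metric m) seq_scale (exclusion_ideal (Rm_metric m) (seq_proj m ` C)) g (\<mu>' m) P
                  (\<lambda>\<omega>. seq_proj m (\<xi> \<omega>))) \<longrightarrow>
       (\<forall>m\<ge>m\<^sub>0. \<forall>B \<in> sets (borel_metric (Rm_metric m)) \<inter> exclusion_ideal (Rm_metric m) (seq_proj m ` C).
          emeasure (\<mu>' m) B = emeasure (distr \<mu> (borel_metric (Rm_metric m)) (seq_proj m)) B))"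
proof (intro conjI iffI allI impI ballI)
  assume "\<exists>\<mu> \<in> ideal_measures seq_metric (exclusion_ideal seq_metric C).
    RV seq_metric seq_scale (exclusion_ideal seq_metric C) g \<mu> P \<xi>"
  then obtain \<mu> where "RV seq_metric seq_scale (exclusion_ideal seq_metric C) g \<mu> P \<xi>" by blast
  from RV_seq_imp_RV_Rm[OF this]
  show "\<forall>\<^sub>F m in sequentially.
      \<exists>\<mu>\<^sub>m \<in> ideal_measures (Rm_metric m) (exclusion_ideal (Rm_metric m) (seq_proj m ` C)).
        RV (Rm_metric m) seq_scale (exclusion_ideal (Rm_metric m) (seq_proj m ` C)) g \<mu>\<^sub>m P
          (\<lambda>\<omega>. seq_proj m (\<xi> \<omega>))"
    by eventually_elim (blast intro: RV_in_ideal_measures)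
next
  assume "\<forall>\<^sub>F m in sequentially.
      \<exists>\<mu>\<^sub>m \<in> ideal_measures (Rm_metric m) (exclusion_ideal (Rm_metric m) (seq_proj m ` C)).
        RV (Rm_metric m) seq_scale (exclusion_ideal (Rm_metric m) (seq_proj m ` C)) g \<mu>\<^sub>m P
          (\<lambda>\<omega>. seq_proj m (\<xi> \<omega>))"
  then obtain N where "\<forall>m. \<exists>\<mu>\<^sub>m. N \<le> m \<longrightarrow>
      RV (Rm_metric m) seq_scale (exclusion_ideal (Rm_metric m) (seq_proj m ` C)) g \<mu>\<^sub>m P
        (\<lambda>\<omega>. seq_proj m (\<xi> \<omega>))"
    unfolding eventually_sequentially by blast
  from choice[OF this] obtain \<mu> where "\<And>m. N \<le> m \<Longrightarrow>
      RV (Rm_metric m) seq_scale (exclusion_ideal (Rm_metric m) (seq_proj m ` C)) g (\<mu> m) P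
        (\<lambda>\<omega>. seq_proj m (\<xi> \<omega>))"
    by blast
  from RV_Rm_imp_RV_seq[OF assms(3,4) this]
  show "\<exists>\<mu> \<in> ideal_measures seq_metric (exclusion_ideal seq_metric C).
      RV seq_metric seq_scale (exclusion_ideal seq_metric C) g \<mu> P \<xi>"
    by (blast intro: RV_in_ideal_measures)
next
  fix \<mu> \<mu>' m\<^sub>0 m B
  assume RV: "RV seq_metric seq_scale (exclusion_ideal seq_metric C) g \<mu> P \<xi> \<and>
     (\<forall>m\<ge>m\<^sub>0. RV (Rm_metric m) seq_scale (exclusion_ideal (Rm_metric m) (seq_proj m ` C)) g (\<mu>' m) P
                (\<lambda>\<omega>. seq_proj m (\<xi> \<omega>)))"
    and m: "m\<^sub>0 \<le> m"
    and B: "B \<in> sets (borel_metric (Rm_metric m)) \<inter> exclusion_ideal (Rm_metric m) (seq_proj m ` C)"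
  have C: "C \<subseteq> mspace seq_metric" by simp
  note D = seq_proj_image_mspace[of m C]
  obtain r where r: "r > 0" "B \<subseteq> far_set (Rm_metric m) (seq_proj m ` C) r"
    using B by (auto simp: exclusion_ideal_iff)
  have \<mu>: "finite_away seq_metric C \<mu>" "scaled_law_tendsto seq_metric seq_scale C g \<mu> P \<xi>"
    using RV ideal_measures_finite_away[OF C] unfolding RV_iff[OF C] by blast+
  have "RV (Rm_metric m) seq_scale (exclusion_ideal (Rm_metric m) (seq_proj m ` C)) g (\<mu>' m) P
      (\<lambda>\<omega>. seq_proj m (\<xi> \<omega>))"
    using RV m by blast
  then have \<mu>': "finite_away (Rm_metric m) (seq_proj m ` C) (\<mu>' m)"
    "scaled_law_tendsto (Rm_metric m) seq_scale (seq_proj m ` C) g (\<mu>' m) P (\<lambda>\<omega>. seq_proj m (\<xi> \<omega>))"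
    using ideal_measures_finite_away[OF D] unfolding RV_iff[OF D] by blast+
  show "emeasure (\<mu>' m) B = emeasure (distr \<mu> (borel_metric (Rm_metric m)) (seq_proj m)) B"
    using B r
    by (intro scaled_law_tendsto_unique[OF D \<mu>'(1) limit_of_projection(1)[OF \<mu>] \<mu>'(2) limit_of_projection(2)[OF \<mu>]])
      auto
qed

end
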